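(* Suppose an oriented regular (possibly virtual) link diagram $D$ contains a tangle, and let $C$ be any directed Euler system for the directed universe $\vec U$ of $D$. Then there are marked, weighted graphs $F$ and $H$, with $V(F)\cap V(H)=\{a\}$, such that $\mathcal{L}(D,C)=F\ast H$, $F-a$ is the subgraph of $\mathcal{L}(D,C)$ induced by the vertices corresponding to (classical) crossings outside the tangle, and $H-a$ is the subgraph of $\mathcal{L}(D,C)$ induced by the vertices corresponding to (classical) crossings inside the tangle. Moreover, it is possible to choose $C$ so that at least one of $F,H$ has no marked vertex adjacent to $a$.
   Context: Link diagrams. An oriented regular link diagram $D$ consists of oriented, piecewise smooth closed curves in the plane that intersect (and self-intersect) only at finitely many transverse crossings; each crossing is either classical (with over- and underpassing arcs specified) or virtual. A tangle in $D$ is a portion of $D$ that can be enclosed by a circle which intersects $D$ in precisely four points (transversely), none of which is a crossing; crossings are inside or outside the tangle according to whether they are inside or outside the circle. Universe and Euler systems. The directed universe $\vec U$ is the 2-in, 2-out digraph whose vertices are the classical crossings of $D$ and whose edges are the arcs of $D$ between classical crossings (virtual crossings are ignored); it also contains a free loop for each link component incident on no classical crossing. $U$ is the undirected version. A directed Euler system $C$ for $\vec U$ contains one directed Euler circuit for each connected component of $U$ (and every free loop). A classical crossing is marked (with respect to $C$) if $C$ does not follow the incident link component(s) there; $C$ is determined by its set of marked crossings. Graphs. A graph is finite and may have loops, multiple edges and free loops (connected components with neither vertices nor edges). A marked graph is a graph each of whose vertices is designated marked or unmarked. A weighted marked graph also has functions $\alpha,\beta:V(G)\to R$, with $R$ a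 commutative ring containing $A,B,d$; a vertex $v$ has standard weights if $\alpha(v)=A$, $\beta(v)=B$. A subgraph is induced if it contains every edge of the graph incident only on its vertices. Looped interlacement graph. $\mathcal{L}(D,C)$ is the marked graph with one vertex for each classical crossing of $D$; marked vertices correspond to marked crossings, looped vertices correspond to negative crossings, and two distinct vertices $v,w$ are adjacent iff they are interlaced with respect to $C$, i.e., some circuit of $C$ meets them in the order $v\dots w\dots v\dots w$. The number of free loops of $\mathcal{L}(D,C)$ is one less than the number of connected components of $U$ (free loops included). Its vertices have standard weights (or, more generally, whatever weights are assigned to the classical crossings of $D$). Composition. A marked, weighted graph $G$ is the composition $F\ast H$ of marked, weighted graphs $F$ and $H$ if: (a) $V(F)\cap V(H)$ consists of a single unlooped, unmarked vertex $a$ that has standard weights in both $F$ and $H$; (b) the elements of $V(G)=V(F)\cup V(H)-\{a\}$ inherit their loops, marks and weights from $F$ and $H$; (c) $E(G)=E(F-a)\cup E(H-a)\cup\{\{v,w\} : \{v,a\}\in E(F)\text{ and }\{a,w\}\in E(H)\}$; (d) $F$ and $H$ do not share any free loop, and the free loops of $G$ are those of $F$ and $H$. (For the induced subgraphs in the claim, free loops are disregarded; they may be distributed in any way between $F$ and $H$.) *)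

theory Defs
  imports "HOL-Analysis.Analysis" "HOL-Library.Uprod" "HOL-Library.Multiset"
    "Graph_Theory.Graph_Theory"
begin

section \<open>Link diagrams\<close>

text \<open>
  The plane is the type of complex numbers.  The link components are numbered
  \<open>0, \<dots>, ncomps - 1\<close>; each is a closed curve given as a 1-periodic function of a real
  parameter, traversed in the direction of increasing parameter.  A \<open>site\<close> \<open>(i, t)\<close> is the
  position with parameter \<open>t \<in> [0, 1)\<close> on the component \<open>i\<close>.  For a classical crossing \<open>p\<close>,
  \<open>over p\<close> is the site of the overpassing arc at \<open>p\<close>.
\<close>

type_synonym site = "nat \<times> real"

record diagram =
  ncomps :: nat
  curve :: "nat \<Rightarrow> real \<Rightarrow> complex"
  classical :: "complex set"
  over :: "complex \<Rightarrow> site"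

definition sites :: "diagram \<Rightarrow> site set" where
  "sites D = {(i, t). i < ncomps D \<and> 0 \<le> t \<and> t < 1}"

definition point :: "diagram \<Rightarrow> site \<Rightarrow> complex" where
  "point D x = curve D (fst x) (snd x)"

definition sites_at :: "diagram \<Rightarrow> complex \<Rightarrow> site set" where
  "sites_at D p = {x \<in> sites D. point D x = p}"

definition crossings :: "diagram \<Rightarrow> complex set" where
  "crossings D = {p. \<exists>x \<in> sites_at D p. \<exists>y \<in> sites_at D p. x \<noteq> y}"

definition transverse :: "(real \<Rightarrow> complex) \<Rightarrow> real \<Rightarrow> (real \<Rightarrow> complex) \<Rightarrow> real \<Rightarrow> bool" where
  "transverse f s g t \<longleftrightarrow>
     (\<exists>u v. (f has_vector_derivative u) (at s) \<and> (g has_vector_derivative v) (at t) \<and>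
            Im (cnj u * v) \<noteq> 0)"

text \<open>\<open>Im (cnj u * v)\<close> is the determinant of the pair of plane vectors \<open>u\<close>, \<open>v\<close>.\<close>

definition link_diagram :: "diagram \<Rightarrow> bool" where
  "link_diagram D \<longleftrightarrow>
     (\<forall>i < ncomps D. (\<forall>t. curve D i (t + 1) = curve D i t) \<and> valid_path (curve D i)) \<and>
     finite (crossings D) \<and>
     (\<forall>p \<in> crossings D. card (sites_at D p) = 2 \<and>
        (\<forall>x \<in> sites_at D p. \<forall>y \<in> sites_at D p. x \<noteq> y \<longrightarrow>
           transverse (curve D (fst x)) (snd x) (curve D (fst y)) (snd y))) \<and>
     classical D \<subseteq> crossings D \<and>
     (\<forall>p \<in> classical D. over D p \<in> sites_at D p)"

text \<open>The crossings outside \<open>classical D\<close> are the virtual ones.\<close>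

definition under :: "diagram \<Rightarrow> complex \<Rightarrow> site" where
  "under D p = (THE x. x \<in> sites_at D p \<and> x \<noteq> over D p)"

definition direction :: "diagram \<Rightarrow> site \<Rightarrow> complex" where
  "direction D x = vector_derivative (curve D (fst x)) (at (snd x))"

text \<open>
  Right-hand rule: a crossing is positive if the overpassing direction is turned
  counterclockwise (through less than a half-turn) to reach the underpassing direction.
\<close>

definition negative_crossing :: "diagram \<Rightarrow> complex \<Rightarrow> bool" where
  "negative_crossing D p \<longleftrightarrow>
     Im (cnj (direction D (over D p)) * direction D (under D p)) < 0"


section \<open>Tangles\<close>

text \<open>
  A circle in the plane is a smoothly embedded one (not necessarily round), parametrized as
  a 1-periodic function.
\<close>

definition plane_circle :: "(real \<Rightarrow> complex) \<Rightarrow> bool" where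
  "plane_circle J \<longleftrightarrow>
     (\<forall>t. J (t + 1) = J t) \<and> inj_on J {0..<1} \<and> J C1_differentiable_on UNIV \<and>
     (\<forall>t. vector_derivative J (at t) \<noteq> 0)"

definition encloses_tangle :: "diagram \<Rightarrow> (real \<Rightarrow> complex) \<Rightarrow> bool" where
  "encloses_tangle D J \<longleftrightarrow>
     plane_circle J \<and>
     card (point D ` sites D \<inter> path_image J) = 4 \<and>
     crossings D \<inter> path_image J = {} \<and>
     (\<forall>x \<in> sites D. \<forall>s \<in> {0..<1}. point D x = J s \<longrightarrow>
        transverse (curve D (fst x)) (snd x) J s)"

definition crossings_inside :: "diagram \<Rightarrow> (real \<Rightarrow> complex) \<Rightarrow> complex set" where
  "crossings_inside D J = {p \<in> classical D. p \<in> inside (path_image J)}"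

definition crossings_outside :: "diagram \<Rightarrow> (real \<Rightarrow> complex) \<Rightarrow> complex set" where
  "crossings_outside D J = {p \<in> classical D. p \<in> outside (path_image J)}"


section \<open>The directed universe and its Euler systems\<close>

text \<open>
  An arc of the diagram between classical crossings is identified with the site at which
  it starts.  \<open>next_site D x\<close> is the site at which the arc starting at \<open>x\<close> ends, i.e.\ the
  next passage of the link component through a classical crossing; it is also the arc that
  follows \<open>x\<close> along its link component.
\<close>

definition next_site :: "diagram \<Rightarrow> site \<Rightarrow> site" where
  "next_site D x =
     (fst x, frac (LEAST s. snd x < s \<and> curve D (fst x) s \<in> classical D))"

definition universe :: "diagram \<Rightarrow> (complex, site) pre_digraph" where
  "universe D =
     \<lparr> verts = classical D,
       arcs = {x \<in> sites D. point D x \<in> classical D},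
       tail = point D,
       head = (\<lambda>x. point D (next_site D x)) \<rparr>"

text \<open>The free loops of the universe, given by the indices of the corresponding link components.\<close>

definition universe_free_loops :: "diagram \<Rightarrow> nat set" where
  "universe_free_loops D =
     {i. i < ncomps D \<and> (\<forall>t \<in> {0..<1}. curve D i t \<notin> classical D)}"

text \<open>Vertex sets of the connected components, other than free loops, of the undirected universe.\<close>

definition universe_components :: "diagram \<Rightarrow> complex set set" where
  "universe_components D = pre_digraph.sccs_verts (with_proj (mk_symmetric (universe D)))"

definition num_components :: "diagram \<Rightarrow> nat" where
  "num_components D = card (universe_components D) + card (universe_free_loops D)"

text \<open>
  A circuit through crossings is the list of its arcs, from an arbitrary starting point.
\<close>

datatype circuit = Free_Loop nat | Arc_Circuit "site list"

definition euler_circuit :: "diagram \<Rightarrow> complex set \<Rightarrow> site list \<Rightarrow> bool" where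
  "euler_circuit D K p \<longleftrightarrow> (\<exists>u. pre_digraph.euler_trail (universe D \<restriction> K) u p u)"

definition euler_system :: "diagram \<Rightarrow> circuit set \<Rightarrow> bool" where
  "euler_system D C \<longleftrightarrow>
     (\<forall>i. Free_Loop i \<in> C \<longleftrightarrow> i \<in> universe_free_loops D) \<and>
     (\<forall>p. Arc_Circuit p \<in> C \<longrightarrow> (\<exists>K \<in> universe_components D. euler_circuit D K p)) \<and>
     (\<forall>K \<in> universe_components D. \<exists>!p. Arc_Circuit p \<in> C \<and> euler_circuit D K p)"

definition marked_crossings :: "diagram \<Rightarrow> circuit set \<Rightarrow> complex set" where
  "marked_crossings D C =
     {v \<in> classical D. \<exists>p k. Arc_Circuit p \<in> C \<and> k < length p \<and>
        head (universe D) (p ! k) = v \<and> p ! (Suc k mod length p) \<noteq> next_site D (p ! k)}"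

text \<open>
  As circuits are cyclic, a list representing a circuit may show the pattern
  \<open>v\<dots>w\<dots>v\<dots>w\<close> in the rotated form \<open>w\<dots>v\<dots>w\<dots>v\<close>.
\<close>

definition interlaced :: "diagram \<Rightarrow> circuit set \<Rightarrow> complex \<Rightarrow> complex \<Rightarrow> bool" where
  "interlaced D C v w \<longleftrightarrow>
     (\<exists>p. Arc_Circuit p \<in> C \<and>
        (\<exists>i j k l. i < j \<and> j < k \<and> k < l \<and> l < length p \<and>
           (let m = (\<lambda>n. tail (universe D) (p ! n)) in
              m i = v \<and> m j = w \<and> m k = v \<and> m l = w \<or>
              m i = w \<and> m j = v \<and> m k = w \<and> m l = v)))"


section \<open>Weighted marked graphs\<close>

text \<open>
  Edges form a multiset of unordered pairs, a loop at \<open>v\<close> being \<open>Upair v v\<close>.  A free loop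
  has neither vertices nor edges, so only the number of free loops is recorded.  The values
  of the weight functions matter on the vertices only.
\<close>

record ('v, 'r) mgraph =
  vertices :: "'v set"
  edges :: "'v uprod multiset"
  marked :: "'v set"
  free_loops :: nat
  alpha :: "'v \<Rightarrow> 'r"
  beta :: "'v \<Rightarrow> 'r"

definition marked_graph :: "('v, 'r) mgraph \<Rightarrow> bool" where
  "marked_graph G \<longleftrightarrow>
     finite (vertices G) \<and> (\<forall>e \<in># edges G. set_uprod e \<subseteq> vertices G) \<and>
     marked G \<subseteq> vertices G"

definition induced_on :: "('v, 'r) mgraph \<Rightarrow> 'v set \<Rightarrow> ('v, 'r) mgraph" where
  "induced_on G S =
     G \<lparr> vertices := vertices G \<inter> S,
         edges := {#e \<in># edges G. set_uprod e \<subseteq> S#},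
         marked := marked G \<inter> S \<rparr>"

definition delete_vertex :: "('v, 'r) mgraph \<Rightarrow> 'v \<Rightarrow> ('v, 'r) mgraph" where
  "delete_vertex G a = induced_on G (vertices G - {a})"

definition equal_upto_free_loops :: "('v, 'r) mgraph \<Rightarrow> ('v, 'r) mgraph \<Rightarrow> bool" where
  "equal_upto_free_loops G G' \<longleftrightarrow>
     vertices G = vertices G' \<and> edges G = edges G' \<and> marked G = marked G' \<and>
     (\<forall>v \<in> vertices G. alpha G v = alpha G' v \<and> beta G v = beta G' v)"

definition standard_weights :: "'r \<Rightarrow> 'r \<Rightarrow> ('v, 'r) mgraph \<Rightarrow> 'v \<Rightarrow> bool" where
  "standard_weights A B G v \<longleftrightarrow> alpha G v = A \<and> beta G v = B"

text \<open>\<open>G\<close> is the composition of \<open>F\<close> and \<open>H\<close> at the common vertex \<open>a\<close>.\<close>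

definition is_composition ::
  "'r::comm_ring_1 \<Rightarrow> 'r \<Rightarrow> ('v, 'r) mgraph \<Rightarrow> ('v, 'r) mgraph \<Rightarrow> 'v \<Rightarrow> ('v, 'r) mgraph \<Rightarrow> bool"
  where
  "is_composition A B F H a G \<longleftrightarrow>
     marked_graph F \<and> marked_graph H \<and> marked_graph G \<and>
     vertices F \<inter> vertices H = {a} \<and>
     Upair a a \<notin># edges F \<and> Upair a a \<notin># edges H \<and>
     a \<notin> marked F \<and> a \<notin> marked H \<and>
     standard_weights A B F a \<and> standard_weights A B H a \<and>
     vertices G = vertices F \<union> vertices H - {a} \<and>
     marked G = marked F \<union> marked H \<and>
     (\<forall>v \<in> vertices F - {a}. alpha G v = alpha F v \<and> beta G v = beta F v) \<and>
     (\<forall>v \<in> vertices H - {a}. alpha G v = alpha H v \<and> beta G v = beta H v) \<and>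
     edges G = edges (delete_vertex F a) + edges (delete_vertex H a) +
       mset_set {Upair v w | v w. Upair v a \<in># edges F \<and> Upair a w \<in># edges H} \<and>
     free_loops G = free_loops F + free_loops H"

definition no_marked_neighbour :: "('v, 'r) mgraph \<Rightarrow> 'v \<Rightarrow> bool" where
  "no_marked_neighbour G a \<longleftrightarrow> \<not> (\<exists>v \<in> marked G. Upair v a \<in># edges G)"


section \<open>The looped interlacement graph\<close>

definition looped_interlacement_graph ::
  "diagram \<Rightarrow> circuit set \<Rightarrow> (complex \<Rightarrow> 'r) \<Rightarrow> (complex \<Rightarrow> 'r) \<Rightarrow> (complex, 'r) mgraph" where
  "looped_interlacement_graph D C \<alpha> \<beta> =
     \<lparr> vertices = classical D,
       edges = mset_set
         ({Upair v v | v. v \<in> classical D \<and> negative_crossing D v} \<union>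
          {Upair v w | v w. v \<in> classical D \<and> w \<in> classical D \<and> v \<noteq> w \<and> interlaced D C v w}),
       marked = marked_crossings D C,
       free_loops = num_components D - 1,
       alpha = \<alpha>,
       beta = \<beta> \<rparr>"

text \<open>
  \<open>F\<close> and \<open>H\<close> decompose the looped interlacement graph \<open>G\<close> of \<open>D\<close> along the tangle
  enclosed by \<open>J\<close>: \<open>F\<close> belongs to the outside and \<open>H\<close> to the inside.
\<close>

definition tangle_decomposition ::
  "'r::comm_ring_1 \<Rightarrow> 'r \<Rightarrow> diagram \<Rightarrow> (real \<Rightarrow> complex) \<Rightarrow> (complex, 'r) mgraph \<Rightarrow>
   (complex, 'r) mgraph \<Rightarrow> (complex, 'r) mgraph \<Rightarrow> complex \<Rightarrow> bool" where
  "tangle_decomposition A B D J G F H a \<longleftrightarrow>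
     is_composition A B F H a G \<and>
     equal_upto_free_loops (delete_vertex F a) (induced_on G (crossings_outside D J)) \<and>
     equal_upto_free_loops (delete_vertex H a) (induced_on G (crossings_inside D J))"

end

theory Submission
  imports Defs
begin

text \<open>
  An arc that joins a crossing inside the circle to one outside must meet the circle, so at most
  four arcs do this.  Hence the Euler circuits change sides at most four times in total, and an
  inside and an outside crossing are interlaced exactly if each of them occurs on both of the
  circuit segments on its side.  The interlacement between the two sides is therefore a complete
  bipartite graph, which is what a composition amounts to.

  For the second claim, transposing an Euler system at two interlaced marked crossings (exchanging
  the two segments that run from one to the other) makes both of them unmarked and keeps all other
  marks.  So if the number of marked crossings is least, then no two marked crossings are interlaced.
  Marked neighbours of \<open>a\<close> in both \<open>F\<close> and \<open>H\<close> would be interlaced.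
\<close>

section \<open>Alternation in coloured sequences\<close>

text \<open>The value at \<open>n\<close> numbers the monochromatic block that contains position
  \<open>n\<close>, so it serves both as a count of colour changes and as a coordinate. The step
  that closes a circuit is left out.\<close>

definition switches :: "(nat \<Rightarrow> bool) \<Rightarrow> nat \<Rightarrow> nat" where
  "switches c n = card {k. k < n \<and> c k \<noteq> c (Suc k)}"

lemma switches_Suc: "switches c (Suc n) = switches c n + (if c n \<noteq> c (Suc n) then 1 else 0)"
proof -
  have "{k. k < Suc n \<and> c k \<noteq> c (Suc k)} =
      (if c n \<noteq> c (Suc n) then insert n {k. k < n \<and> c k \<noteq> c (Suc k)}
       else {k. k < n \<and> c k \<noteq> c (Suc k)})"
    by (auto simp: less_Suc_eq)
  then show ?thesis by (auto simp: switches_def)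
qed

text \<open>With two colours every switch toggles, so the colour of a position is read off from the
  parity of its block number.\<close>

lemma even_switches_iff: "even (switches c n) \<longleftrightarrow> c n = c 0"
  by (induction n) (auto simp: switches_Suc, simp add: switches_def)

lemma switches_mono: "m \<le> n \<Longrightarrow> switches c m \<le> switches c n"
  by (induction n rule: dec_induct) (auto simp: switches_Suc)

lemma less_if_switches_less: "switches c m < switches c n \<Longrightarrow> m < n"
  using switches_mono[of n m c] by linarith

definition alternating :: "(nat \<Rightarrow> 'a) \<Rightarrow> nat \<Rightarrow> 'a \<Rightarrow> 'a \<Rightarrow> bool" where
  "alternating m N v w \<longleftrightarrow>
    (\<exists>i j k l. i < j \<and> j < k \<and> k < l \<and> l < N \<and>
      (m i = v \<and> m j = w \<and> m k = v \<and> m l = w \<or> m i = w \<and> m j = v \<and> m k = w \<and> m l = v))"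

lemma alternating_commute: "alternating m N v w \<longleftrightarrow> alternating m N w v"
  unfolding alternating_def by (subst disj_commute) (rule refl)

text \<open>Four positions of alternating colours need three switches between them, and at most four
  are available. So \<open>v\<close> occurs in two blocks of its colour with one block between them.
  The second conclusion later excludes two circuits: three switches in each would be too
  many.\<close>

lemma alternating_switches:
  assumes alt: "alternating m N v w" and diff: "(v \<in> R) \<noteq> (w \<in> R)"
    and le: "\<And>n. n < N \<Longrightarrow> switches (\<lambda>n. m n \<in> R) n \<le> 4"
  defines "b \<equiv> switches (\<lambda>n. m n \<in> R)"
  shows "\<exists>i k. k < N \<and> m i = v \<and> m k = v \<and> b k = b i + 2 \<and> b i \<le> 2"
    and "\<exists>n < N. b n \<ge> 3"
proof -
  obtain i j k l where ijkl: "i < j" "j < k" "k < l" "l < N"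
    and pat: "m i = v \<and> m j = w \<and> m k = v \<and> m l = w \<or> m i = w \<and> m j = v \<and> m k = w \<and> m l = v"
    using alt unfolding alternating_def by blast
  have "even (b i) \<noteq> even (b j)" "even (b j) \<noteq> even (b k)" "even (b k) \<noteq> even (b l)"
    using pat diff unfolding b_def even_switches_iff by auto
  moreover have "b i \<le> b j" "b j \<le> b k" "b k \<le> b l" "b l \<le> 4"
    using ijkl le unfolding b_def by (auto intro!: switches_mono)
  \<comment> \<open>The three increments are odd and nonnegative with sum at most 4, hence each of
    them is 1.\<close>
  ultimately have b: "b j = b i + 1" "b k = b i + 2" "b l = b i + 3" "b i \<le> 1"
    by presburger+
  show "\<exists>i k. k < N \<and> m i = v \<and> m k = v \<and> b k = b i + 2 \<and> b i \<le> 2"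
    using pat
  proof
    assume "m i = v \<and> m j = w \<and> m k = v \<and> m l = w"
    with b ijkl show ?thesis by (intro exI[of _ i] exI[of _ k]) simp
  next
    assume "m i = w \<and> m j = v \<and> m k = w \<and> m l = v"
    with b ijkl show ?thesis by (intro exI[of _ j] exI[of _ l]) simp
  qed
  show "\<exists>n < N. b n \<ge> 3" using b ijkl by (intro exI[of _ l]) simp
qed

text \<open>
  The reason is that at most four switches leave at most two blocks of either colour, so vertices
  of different colours alternate if and only if each of them occurs in both blocks of its colour.
\<close>

lemma alternating_rectangle:
  assumes alt: "alternating m N v w" "alternating m N v' w'"
    and R: "(v \<in> R) \<noteq> (w \<in> R)" "v' \<in> R \<longleftrightarrow> v \<in> R" "w' \<in> R \<longleftrightarrow> w \<in> R"
    and le: "\<And>n. n < N \<Longrightarrow> switches (\<lambda>n. m n \<in> R) n \<le> 4"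
  shows "alternating m N v w'"
proof -
  let ?b = "switches (\<lambda>n. m n \<in> R)"
  obtain i k where ik: "k < N" "m i = v" "m k = v" "?b k = ?b i + 2" "?b i \<le> 2"
    using alternating_switches(1)[OF alt(1) R(1) le] by blast
  have "alternating m N w' v'" using alt(2) by (simp add: alternating_commute)
  moreover have "(w' \<in> R) \<noteq> (v' \<in> R)" using R by simp
  ultimately obtain j l where jl: "l < N" "m j = w'" "m l = w'" "?b l = ?b j + 2" "?b j \<le> 2"
    using alternating_switches(1)[of m N w' v' R] le by blast
  \<comment> \<open>The colours differ, so the block numbers of \<open>i\<close> and
    \<open>j\<close> differ in parity. Both are at most 2, so they differ by exactly 1, and the two
    blocks of \<open>v\<close> interleave with those of \<open>w'\<close>.\<close>
  have "even (?b i) \<noteq> even (?b j)"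
    unfolding even_switches_iff using R ik(2) jl(2) by auto
  then have "?b i + 1 = ?b j \<or> ?b j + 1 = ?b i" using ik(5) jl(5) by presburger
  then show ?thesis
  proof
    assume "?b i + 1 = ?b j"
    then have "i < j" "j < k" "k < l"
      using ik(4) jl(4)
      by (simp_all add: less_if_switches_less[of "\<lambda>n. m n \<in> R"])
    with ik jl show ?thesis
      unfolding alternating_def by (intro exI[of _ i] exI[of _ j] exI[of _ k] exI[of _ l]) simp
  next
    assume "?b j + 1 = ?b i"
    then have "j < i" "i < l" "l < k"
      using ik(4) jl(4)
      by (simp_all add: less_if_switches_less[of "\<lambda>n. m n \<in> R"])
    with ik jl show ?thesis
      unfolding alternating_def by (intro exI[of _ j] exI[of _ i] exI[of _ l] exI[of _ k]) simp
  qed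
qed

section \<open>Compositions of marked graphs\<close>

text \<open>Both factors of the composition arise by adding \<open>a\<close> to an induced subgraph.
  For a fresh \<open>a\<close> and \<open>N\<close> among the old vertices of a marked graph,
  \<open>a\<close> is unlooped, unmarked and of standard weights by construction.\<close>

definition attach_vertex ::
  "'r \<Rightarrow> 'r \<Rightarrow> 'v \<Rightarrow> 'v set \<Rightarrow> ('v, 'r) mgraph \<Rightarrow> ('v, 'r) mgraph" where
  "attach_vertex A B a N G = G
    \<lparr> vertices := insert a (vertices G),
      edges := edges G + mset_set ((\<lambda>v. Upair v a) ` N),
      alpha := (alpha G)(a := A),
      beta := (beta G)(a := B) \<rparr>"

lemma attach_vertex_simps [simp]:
  "vertices (attach_vertex A B a N G) = insert a (vertices G)"
  "marked (attach_vertex A B a N G) = marked G"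
  "free_loops (attach_vertex A B a N G) = free_loops G"
  "alpha (attach_vertex A B a N G) = (alpha G)(a := A)"
  "beta (attach_vertex A B a N G) = (beta G)(a := B)"
  by (simp_all add: attach_vertex_def)

lemma attach_vertex_edge_iff:
  assumes "marked_graph G" "a \<notin> vertices G" "N \<subseteq> vertices G"
  shows "Upair v a \<in># edges (attach_vertex A B a N G) \<longleftrightarrow> v \<in> N"
proof -
  have "finite N" using assms finite_subset by (auto simp: marked_graph_def)
  moreover have "Upair v a \<notin># edges G" using assms by (auto simp: marked_graph_def)
  ultimately show ?thesis
    using assms(2,3) by (auto simp: attach_vertex_def)
qed

lemma marked_graph_attach_vertex:
  assumes "marked_graph G" "a \<notin> vertices G" "N \<subseteq> vertices G"
  shows "marked_graph (attach_vertex A B a N G)"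
proof -
  have "finite N" using assms finite_subset by (auto simp: marked_graph_def)
  with assms show ?thesis by (fastforce simp: marked_graph_def attach_vertex_def)
qed

lemma edges_delete_attached_vertex:
  assumes "marked_graph G" "a \<notin> vertices G" "N \<subseteq> vertices G"
  shows "edges (delete_vertex (attach_vertex A B a N G) a) = edges G"
proof -
  have "finite N" using assms finite_subset by (auto simp: marked_graph_def)
  moreover have "filter_mset (\<lambda>e. set_uprod e \<subseteq> vertices G - {a}) (edges G) = edges G"
    using assms by (intro filter_mset_eq_conv[THEN iffD2]) (auto simp: marked_graph_def)
  moreover have "{e \<in> (\<lambda>v. Upair v a) ` N. set_uprod e \<subseteq> vertices G - {a}} = {}" by auto
  ultimately show ?thesis
    by (simp add: delete_vertex_def induced_on_def attach_vertex_def filter_mset_mset_set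
        del: Collect_empty_eq)
qed

lemma marked_graph_induced_on: "marked_graph G \<Longrightarrow> marked_graph (induced_on G (vertices G \<inter> S))"
  by (auto simp: marked_graph_def induced_on_def)

lemma equal_upto_free_loops_attach_vertex:
  assumes "marked_graph G" "a \<notin> vertices G" "N \<subseteq> vertices G"
  shows "equal_upto_free_loops (delete_vertex (attach_vertex A B a N G) a) G"
  unfolding equal_upto_free_loops_def edges_delete_attached_vertex[OF assms]
  using assms by (auto simp: delete_vertex_def induced_on_def marked_graph_def)

text \<open>A composition joins every neighbour of \<open>a\<close> in \<open>F\<close> to every
  neighbour of \<open>a\<close> in \<open>H\<close>, each pair once. So a graph without multiple
  edges splits if its cut between \<open>S\<close> and \<open>T\<close> is complete bipartite on
  \<open>M\<close> and \<open>N\<close>, which become the neighbourhoods of \<open>a\<close>. All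
  free loops go to \<open>F\<close>.\<close>

lemma is_composition_cut:
  fixes G :: "('v, 'r::comm_ring_1) mgraph" and A B :: 'r
  assumes G: "marked_graph G" "edges G = mset_set E" "finite E"
    and V: "vertices G = S \<union> T" "S \<inter> T = {}" "a \<notin> S \<union> T"
    and N: "M \<subseteq> S" "N \<subseteq> T"
    and cut: "\<forall>v \<in> S. \<forall>w \<in> T. Upair v w \<in> E \<longleftrightarrow> v \<in> M \<and> w \<in> N"
  defines "F \<equiv> attach_vertex A B a M (induced_on G S)"
    and "H \<equiv> (attach_vertex A B a N (induced_on G T))\<lparr>free_loops := 0\<rparr>"
  shows "is_composition A B F H a G"
    and "equal_upto_free_loops (delete_vertex F a) (induced_on G S)"
    and "equal_upto_free_loops (delete_vertex H a) (induced_on G T)"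
    and "no_marked_neighbour F a \<longleftrightarrow> M \<inter> marked G = {}"
    and "no_marked_neighbour H a \<longleftrightarrow> N \<inter> marked G = {}"
proof -
  let ?GS = "induced_on G S" and ?GT = "induced_on G T"
  have VS [simp]: "vertices ?GS = S" "vertices ?GT = T"
    using V by (auto simp: induced_on_def)
  have mg: "marked_graph ?GS" "marked_graph ?GT"
    using marked_graph_induced_on[OF G(1), of S] marked_graph_induced_on[OF G(1), of T] V
    by (simp_all add: Int_absorb1)
  have S: "a \<notin> vertices ?GS" "M \<subseteq> vertices ?GS" and T: "a \<notin> vertices ?GT" "N \<subseteq> vertices ?GT"
    using V N by auto
  note S = mg(1) S and T = mg(2) T
  have F_edge: "Upair v a \<in># edges F \<longleftrightarrow> v \<in> M" for v
    unfolding F_def by (rule attach_vertex_edge_iff[OF S])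
  have H_edge: "Upair v a \<in># edges H \<longleftrightarrow> v \<in> N" for v
    unfolding H_def using attach_vertex_edge_iff[OF T, of v A B] by simp
  have H_edge': "Upair a v \<in># edges H \<longleftrightarrow> v \<in> N" for v
  proof -
    have "Upair a v = Upair v a" by simp
    then show ?thesis using H_edge[of v] by metis
  qed
  have mgF: "marked_graph F" unfolding F_def by (rule marked_graph_attach_vertex[OF S])
  have mgH: "marked_graph H"
    using marked_graph_attach_vertex[OF T, of A B] by (simp add: H_def marked_graph_def)
  have edF: "edges (delete_vertex F a) = edges ?GS"
    unfolding F_def by (rule edges_delete_attached_vertex[OF S])
  have edH: "edges (delete_vertex H a) = edges ?GT"
    using edges_delete_attached_vertex[OF T, of A B]
    by (simp add: H_def delete_vertex_def induced_on_def)
  let ?X = "{Upair v w | v w. v \<in> M \<and> w \<in> N}"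
  let ?ES = "{e \<in> E. set_uprod e \<subseteq> S}" and ?ET = "{e \<in> E. set_uprod e \<subseteq> T}"
  have E_sub: "set_uprod e \<subseteq> S \<union> T" if "e \<in> E" for e
    using G V that by (auto simp: marked_graph_def)
  have E_split: "E = ?ES \<union> ?ET \<union> ?X"
  proof (intro equalityI subsetI)
    fix e assume e: "e \<in> E"
    obtain x y where xy: "e = Upair x y" by (cases e)
    with E_sub[OF e] have "x \<in> S \<union> T" "y \<in> S \<union> T" by auto
    then consider "x \<in> S" "y \<in> S" | "x \<in> T" "y \<in> T" | "x \<in> S" "y \<in> T" | "x \<in> T" "y \<in> S" by blast
    then show "e \<in> ?ES \<union> ?ET \<union> ?X"
    proof cases
      case 3
      with cut e xy show ?thesis by auto
    next
      case 4
      moreover have yx: "e = Upair y x" using xy by simp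
      ultimately have "y \<in> M" "x \<in> N" using cut e by auto
      with yx show ?thesis by blast
    qed (use e xy in auto)
  next
    fix e assume "e \<in> ?ES \<union> ?ET \<union> ?X"
    with cut N show "e \<in> E" by blast
  qed
  have X: "set_uprod e \<inter> S \<noteq> {}" "set_uprod e \<inter> T \<noteq> {}" if "e \<in> ?X" for e
    using that N by auto
  have "edges G = mset_set ?ES + mset_set ?ET + mset_set ?X"
  proof -
    have fin: "finite ?ES" "finite ?ET" "finite ?X"
      using E_split G(3) by (auto intro: finite_subset)
    \<comment> \<open>\<open>mset_set\<close> turns only disjoint unions into sums. An edge has at
      least one endpoint, so it cannot lie within both \<open>S\<close> and
      \<open>T\<close>.\<close>
    have "set_uprod e \<noteq> {}" for e :: "'v uprod" by (cases e) auto
    then have "?ES \<inter> ?ET = {}" using V(2) by fastforce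
    moreover have "(?ES \<union> ?ET) \<inter> ?X = {}"
    proof -
      have False if "e \<in> ?ES \<union> ?ET" "e \<in> ?X" for e
        using X[OF that(2)] that(1) V(2) by blast
      then show ?thesis by blast
    qed
    ultimately have "mset_set (?ES \<union> ?ET \<union> ?X) = mset_set ?ES + mset_set ?ET + mset_set ?X"
      using fin by (simp add: mset_set_Union)
    then show ?thesis using E_split G(2) by simp
  qed
  moreover have "edges ?GS = mset_set ?ES" "edges ?GT = mset_set ?ET"
    using G by (simp_all add: induced_on_def filter_mset_mset_set)
  ultimately have edges: "edges G = edges (delete_vertex F a) + edges (delete_vertex H a) +
      mset_set {Upair v w | v w. Upair v a \<in># edges F \<and> Upair a w \<in># edges H}"
    by (simp only: edF edH F_edge H_edge')
  have vert: "vertices F = insert a S" "vertices H = insert a T"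
    by (simp_all add: F_def H_def)
  have marked: "marked F = marked G \<inter> S" "marked H = marked G \<inter> T"
    by (simp_all add: F_def H_def induced_on_def)
  have marked_G: "marked G \<subseteq> S \<union> T" using G(1) V by (simp add: marked_graph_def)
  have weights: "alpha F = (alpha G)(a := A)" "beta F = (beta G)(a := B)"
    "alpha H = (alpha G)(a := A)" "beta H = (beta G)(a := B)"
    "free_loops F = free_loops G" "free_loops H = 0"
    by (simp_all add: F_def H_def induced_on_def)
  show "is_composition A B F H a G"
    unfolding is_composition_def
    using mgF mgH G(1) F_edge[of a] H_edge[of a] N V edges marked_G
    by (intro conjI) (auto simp: vert marked weights standard_weights_def)
  show "equal_upto_free_loops (delete_vertex F a) (induced_on G S)"
    unfolding F_def by (rule equal_upto_free_loops_attach_vertex[OF S])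
  show "equal_upto_free_loops (delete_vertex H a) (induced_on G T)"
  proof -
    have "equal_upto_free_loops (delete_vertex (K\<lparr>free_loops := 0\<rparr>) a) L \<longleftrightarrow>
        equal_upto_free_loops (delete_vertex K a) L" for K L :: "('v, 'r) mgraph"
      by (simp add: equal_upto_free_loops_def delete_vertex_def induced_on_def)
    then show ?thesis
      unfolding H_def using equal_upto_free_loops_attach_vertex[OF T] by blast
  qed
  show "no_marked_neighbour F a \<longleftrightarrow> M \<inter> marked G = {}"
    "no_marked_neighbour H a \<longleftrightarrow> N \<inter> marked G = {}"
    unfolding no_marked_neighbour_def F_edge H_edge marked using N by auto
qed

section \<open>Arcs of a link diagram\<close>

locale oriented_diagram =
  fixes D :: diagram
  assumes link_diagram: "link_diagram D"
begin

section \<open>Periodicity and continuity of the link components\<close>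

lemma curve_period_1: "i < ncomps D \<Longrightarrow> curve D i (t + 1) = curve D i t"
  and valid_path_curve: "i < ncomps D \<Longrightarrow> valid_path (curve D i)"
  and finite_crossings: "finite (crossings D)"
  and card_sites_at_crossing: "p \<in> crossings D \<Longrightarrow> card (sites_at D p) = 2"
  and classical_subset: "classical D \<subseteq> crossings D"
  using link_diagram by (simp_all add: link_diagram_def)

lemma curve_period:
  assumes "i < ncomps D"
  shows "curve D i (t + of_int n) = curve D i t"
proof (induction n rule: int_induct[where k = 0])
  case base
  show ?case by simp
next
  case (step1 n)
  have "curve D i ((t + of_int n) + 1) = curve D i (t + of_int n)"
    by (rule curve_period_1[OF assms])
  with step1 show ?case by (simp add: add.assoc)
next
  case (step2 n)
  have "curve D i ((t + of_int (n - 1)) + 1) = curve D i (t + of_int (n - 1))"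
    by (rule curve_period_1[OF assms])
  with step2 show ?case by simp
qed

lemma curve_frac:
  assumes "i < ncomps D"
  shows "curve D i (frac t) = curve D i t"
  using curve_period[OF assms, of t "- \<lfloor>t\<rfloor>"] by (simp add: frac_def)

text \<open>An arc starts in [0, 1) and takes at most one full turn, so two periods glued at 1
  contain all of it.\<close>

lemma continuous_curve:
  assumes "i < ncomps D"
  shows "continuous_on {0..2} (curve D i)"
proof -
  have *: "continuous_on {0..1} (curve D i)"
    using valid_path_imp_path[OF valid_path_curve[OF assms]] by (simp add: path_def)
  have "continuous_on {1..2} (\<lambda>t. curve D i (t - 1))"
    by (rule continuous_on_compose2[OF *]) (auto intro!: continuous_intros)
  moreover have "curve D i (t - 1) = curve D i t" for t
    using curve_period[OF assms, of t "-1"] by simp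
  ultimately have "continuous_on ({0..1} \<union> {1..2}) (curve D i)"
    by (intro continuous_on_closed_Un *) auto
  moreover have "{0..1} \<union> {1..2} = {0..2::real}" by auto
  ultimately show ?thesis by simp
qed

lemma frac_in_sites:
  assumes "i < ncomps D"
  shows "(i, frac t) \<in> sites D" and "point D (i, frac t) = curve D i t"
  using assms by (auto simp: sites_def point_def curve_frac frac_lt_1)

section \<open>Finiteness of the universe, and its arcs as parameter intervals\<close>

lemma card_sites_at:
  assumes "p \<in> classical D"
  shows "card (sites_at D p) = 2"
  using assms card_sites_at_crossing classical_subset by blast

lemma finite_classical: "finite (classical D)"
  using finite_crossings classical_subset by (rule rev_finite_subset)

lemma finite_arcs: "finite (arcs (universe D))"
proof -
  have "arcs (universe D) = (\<Union>p\<in>classical D. sites_at D p)"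
    by (auto simp: universe_def sites_at_def)
  moreover have "finite (sites_at D p)" if "p \<in> classical D" for p
    using card_sites_at[OF that] card.infinite by fastforce
  ultimately show ?thesis using finite_classical by simp
qed

lemma card_tail_eq:
  assumes "p \<in> classical D"
  shows "card {x \<in> arcs (universe D). tail (universe D) x = p} = 2"
proof -
  have "{x \<in> arcs (universe D). tail (universe D) x = p} = sites_at D p"
    using assms by (auto simp: universe_def sites_at_def)
  with card_sites_at[OF assms] show ?thesis by simp
qed

text \<open>Numbers with equal fractional parts differ by an integer, and within this window by less
  than 1. Parameters in the turn after \<open>t\<close> can thus be compared as reals instead of
  modulo 1.\<close>

lemma inj_on_frac: "inj_on frac {t<..t + 1 :: real}"
proof (rule inj_onI)
  fix x y :: real
  assume "x \<in> {t<..t + 1}" "y \<in> {t<..t + 1}" "frac x = frac y"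
  then have "\<bar>\<lfloor>x\<rfloor> - \<lfloor>y\<rfloor>\<bar> < 1" "x - y = of_int (\<lfloor>x\<rfloor> - \<lfloor>y\<rfloor>)"
    by (auto simp: frac_def)
  then show "x = y" by simp
qed

text \<open>The value is not reduced modulo 1, so an arc is a genuine real interval starting at
  \<open>t\<close> even if it runs past the parameter 1.\<close>

definition next_time :: "nat \<Rightarrow> real \<Rightarrow> real" where
  "next_time i t = (LEAST s. t < s \<and> curve D i s \<in> classical D)"

lemma next_site_eq: "next_site D (i, t) = (i, frac (next_time i t))"
  by (simp add: next_site_def next_time_def)

lemma arc_iff:
  "(i, t) \<in> arcs (universe D) \<longleftrightarrow> i < ncomps D \<and> 0 \<le> t \<and> t < 1 \<and> curve D i t \<in> classical D"
  by (auto simp: universe_def sites_def point_def)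

text \<open>A \<open>LEAST\<close> over the reals needs an attained minimum. Only finitely many
  parameters in (t, t + 1] lead to classical crossings, since \<open>frac\<close> embeds them into
  the finite set of arcs. The endpoint t + 1 is one of them, as it returns to the start; it is the
  only one if the component has a single classical passage.\<close>

lemma next_time:
  assumes "(i, t) \<in> arcs (universe D)"
  shows "t < next_time i t" and "next_time i t \<le> t + 1"
    and "curve D i (next_time i t) \<in> classical D"
    and "\<And>s. t < s \<Longrightarrow> curve D i s \<in> classical D \<Longrightarrow> next_time i t \<le> s"
proof -
  have i: "i < ncomps D" and t: "curve D i t \<in> classical D" using assms by (auto simp: arc_iff)
  define T where "T = {s \<in> {t<..t + 1}. curve D i s \<in> classical D}"
  have "(\<lambda>s. (i, frac s)) ` T \<subseteq> arcs (universe D)"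
    using i by (auto simp: T_def arc_iff curve_frac frac_lt_1)
  moreover have "inj_on (\<lambda>s. (i, frac s)) T"
    using inj_on_frac[of t] by (auto simp: inj_on_def T_def)
  ultimately have fin: "finite T" using finite_arcs finite_imageD finite_subset by metis
  have ne: "t + 1 \<in> T"
    using t curve_period[OF i, of t 1] by (simp add: T_def)
  have min: "Min T \<le> s" if "t < s" "curve D i s \<in> classical D" for s
  proof (cases "s \<le> t + 1")
    case True
    with that fin show ?thesis by (intro Min_le) (auto simp: T_def)
  next
    case False
    with Min_le[OF fin ne] show ?thesis by simp
  qed
  have "Min T \<in> T" using fin ne by (intro Min_in) auto
  then have "next_time i t = Min T"
    unfolding next_time_def using min by (intro Least_equality) (auto simp: T_def)
  then show "t < next_time i t" "next_time i t \<le> t + 1"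
      "curve D i (next_time i t) \<in> classical D"
      "\<And>s. t < s \<Longrightarrow> curve D i s \<in> classical D \<Longrightarrow> next_time i t \<le> s"
    using \<open>Min T \<in> T\<close> min by (auto simp: T_def)
qed

lemma head_eq:
  "(i, t) \<in> arcs (universe D) \<Longrightarrow> head (universe D) (i, t) = curve D i (next_time i t)"
  by (simp add: universe_def next_site_eq frac_in_sites(2) sites_def)

text \<open>The later start is a candidate for the end of the earlier arc, and t + 1, where the
  earlier arc starts anew, is one for the end of the later arc. So the two intervals lie side by
  side within a single turn.\<close>

lemma next_time_mono:
  assumes "(i, t) \<in> arcs (universe D)" "(i, t') \<in> arcs (universe D)" "t < t'"
  shows "next_time i t \<le> t'" and "next_time i t' \<le> t + 1"
  using assms next_time(4)[OF assms(1)] next_time(4)[OF assms(2), of "t + 1"]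
    curve_period[of i t 1] by (auto simp: arc_iff)

lemma next_site_in_arcs: "x \<in> arcs (universe D) \<Longrightarrow> next_site D x \<in> arcs (universe D)"
  using next_time(3) by (cases x) (auto simp: next_site_eq arc_iff curve_frac frac_lt_1)

text \<open>The end parameters of two arcs of one component are different and lie within one turn,
  hence they differ modulo 1.\<close>

lemma inj_on_next_site: "inj_on (next_site D) (arcs (universe D))"
proof -
  have False if arcs: "(i, t) \<in> arcs (universe D)" "(i, t') \<in> arcs (universe D)" and less: "t < t'"
    and eq: "frac (next_time i t) = frac (next_time i t')" for i t t'
  proof -
    note next_time_mono[OF arcs less] next_time(1)[OF arcs(1)] next_time(1)[OF arcs(2)]
    then have "next_time i t \<in> {t<..t + 1}" "next_time i t' \<in> {t<..t + 1}"
      "next_time i t < next_time i t'"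
      using less by auto
    with inj_on_frac[of t] eq show False by (auto dest: inj_onD)
  qed
  note * = this
  show ?thesis
  proof (rule inj_onI)
    fix x y
    assume "x \<in> arcs (universe D)" "y \<in> arcs (universe D)" "next_site D x = next_site D y"
    moreover obtain i t j u where "x = (i, t)" "y = (j, u)" by (cases x, cases y)
    ultimately show "x = y"
      using *[of i t u] *[of i u t] by (cases t u rule: linorder_cases) (auto simp: next_site_eq)
  qed
qed

text \<open>An injective self-map of a finite set is a permutation, and following the component
  carries the arcs ending at \<open>p\<close> to those starting there. So in-degree equals
  out-degree.\<close>

lemma card_head_eq:
  assumes "p \<in> classical D"
  shows "card {x \<in> arcs (universe D). head (universe D) x = p} = 2"
proof -
  let ?S = "arcs (universe D)"
  have surj: "next_site D ` ?S = ?S"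
    using inj_on_next_site finite_arcs next_site_in_arcs by (intro endo_inj_surj) auto
  have "next_site D ` {x \<in> ?S. head (universe D) x = p} = {x \<in> ?S. tail (universe D) x = p}"
    (is "_ ` ?A = ?B")
  proof
    show "next_site D ` ?A \<subseteq> ?B"
      using next_site_in_arcs by (auto simp: universe_def)
    show "?B \<subseteq> next_site D ` ?A"
    proof
      fix y assume y: "y \<in> ?B"
      with surj obtain x where "x \<in> ?S" "y = next_site D x" by blast
      with y show "y \<in> next_site D ` ?A" by (auto simp: universe_def)
    qed
  qed
  moreover have "inj_on (next_site D) ?A"
    using inj_on_next_site by (rule inj_on_subset) auto
  note card_image[OF this]
  ultimately show ?thesis using card_tail_eq[OF assms] by simp
qed

section \<open>Arcs between the two sides of a curve\<close>

lemma universe_simps [simp]: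
  "verts (universe D) = classical D" "tail (universe D) = point D"
  "head (universe D) x = point D (next_site D x)"
  by (simp_all add: universe_def)

lemma tail_in_classical: "x \<in> arcs (universe D) \<Longrightarrow> point D x \<in> classical D"
  by (simp add: universe_def)

text \<open>Only the ends count: an arc that leaves \<open>R\<close> and comes back is not included.
  \<open>R\<close> is arbitrary because the interlacement argument uses nothing but the number of
  these arcs.\<close>

definition crossing_arcs :: "complex set \<Rightarrow> site set" where
  "crossing_arcs R = {x \<in> arcs (universe D). (point D x \<in> R) \<noteq> (point D (next_site D x) \<in> R)}"

text \<open>The arc is connected; if it avoided \<open>L\<close>, its ends would be in one component
  of the complement and so on the same side. The meeting parameter is strictly between the ends,
  since these are classical crossings and lie off \<open>L\<close>.\<close>

lemma crossing_arc_meets: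
  assumes "(i, t) \<in> crossing_arcs (inside L)" and "classical D \<inter> L = {}"
  obtains s where "t < s" "s < next_time i t" "curve D i s \<in> L"
proof -
  have arc: "(i, t) \<in> arcs (universe D)" using assms by (auto simp: crossing_arcs_def)
  let ?u = "next_time i t"
  have t: "i < ncomps D" "0 \<le> t" "t < 1" using arc by (auto simp: arc_iff)
  have u: "t < ?u" "?u \<le> t + 1" using next_time[OF arc] by auto
  have ends: "curve D i t \<in> classical D" "curve D i ?u \<in> classical D"
    using arc next_time(3)[OF arc] by (auto simp: arc_iff)
  have diff: "(curve D i t \<in> inside L) \<noteq> (curve D i ?u \<in> inside L)"
    using assms(1) head_eq[OF arc] by (auto simp: crossing_arcs_def point_def)
  have "Topological_Spaces.connected (curve D i ` {t..?u})"
    using t u by (intro connected_continuous_image continuous_on_subset[OF continuous_curve]) auto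
  then have "connected_component (- L) (curve D i t) (curve D i ?u)"
    if "curve D i ` {t..?u} \<subseteq> - L"
    using that u unfolding connected_component_def by (intro exI[of _ "curve D i ` {t..?u}"]) auto
  then have "\<not> curve D i ` {t..?u} \<subseteq> - L"
    using diff inside_same_component connected_component_sym by metis
  then obtain s where s: "t \<le> s" "s \<le> ?u" "curve D i s \<in> L" by auto
  moreover have "s \<noteq> t" "s \<noteq> ?u" using s ends assms(2) by auto
  ultimately show ?thesis using that by force
qed

text \<open>
  Different arcs that pass between inside and outside meet the curve at different points, as
  these points are not crossings.
\<close>

lemma card_crossing_arcs:
  assumes card: "card (point D ` sites D \<inter> L) = n" "n > 0" and disj: "crossings D \<inter> L = {}"
  shows "card (crossing_arcs (inside L)) \<le> n"
proof -
  have disj': "classical D \<inter> L = {}"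
    using disj classical_subset by blast
  define f where "f x = (SOME s. snd x < s \<and> s < next_time (fst x) (snd x) \<and> curve D (fst x) s \<in> L)" for x
  have f: "snd x < f x \<and> f x < next_time (fst x) (snd x) \<and> curve D (fst x) (f x) \<in> L"
    if "x \<in> crossing_arcs (inside L)" for x
    unfolding f_def
  proof (rule someI_ex)
    have "(fst x, snd x) \<in> crossing_arcs (inside L)" using that by simp
    then show "\<exists>s>snd x. s < next_time (fst x) (snd x) \<and> curve D (fst x) s \<in> L"
      using disj' by (rule crossing_arc_meets) blast
  qed
  let ?g = "\<lambda>x. (fst x, frac (f x))"
  have arc: "x \<in> arcs (universe D)" if "x \<in> crossing_arcs (inside L)" for x
    using that by (simp add: crossing_arcs_def)
  have g: "?g x \<in> sites D" "point D (?g x) = curve D (fst x) (f x)"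
    if "x \<in> crossing_arcs (inside L)" for x
    using frac_in_sites[of "fst x" "f x"] arc[OF that] arc_iff[of "fst x" "snd x"] by auto
  have "inj_on (\<lambda>x. point D (?g x)) (crossing_arcs (inside L))"
  proof (rule inj_onI)
    fix x y
    assume x: "x \<in> crossing_arcs (inside L)" and y: "y \<in> crossing_arcs (inside L)"
      and eq: "point D (?g x) = point D (?g y)"
    have "point D (?g x) \<notin> crossings D" using f[OF x] g[OF x] disj by auto
    then have eq': "fst x = fst y" "frac (f x) = frac (f y)"
      using g(1)[OF x] g(1)[OF y] eq unfolding crossings_def sites_at_def by auto
    \<comment> \<open>Different arcs of one component occupy intervals side by side in one turn, so
      parameters in their interiors cannot agree modulo 1.\<close>
    have False if x: "x \<in> crossing_arcs (inside L)" and y: "y \<in> crossing_arcs (inside L)"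
      and eq: "fst x = fst y" "frac (f x) = frac (f y)" and less: "snd x < snd y" for x y
    proof -
      obtain i t t' where xy: "x = (i, t)" "y = (i, t')" "t < t'"
        using eq(1) less by (cases x, cases y) simp
      have "next_time i t \<le> t'" "next_time i t' \<le> t + 1"
        using next_time_mono arc[OF x] arc[OF y] xy by auto
      then have "f x \<in> {t<..t + 1}" "f y \<in> {t<..t + 1}" "f x < f y"
        using f[OF x] f[OF y] xy by auto
      with inj_on_frac[of t] eq(2) show False by (auto dest: inj_onD)
    qed
    from this[OF x y] this[OF y x] eq' show "x = y"
      by (cases "snd x" "snd y" rule: linorder_cases) (auto simp: prod_eq_iff)
  qed
  moreover have "(\<lambda>x. point D (?g x)) ` crossing_arcs (inside L) \<subseteq> point D ` sites D \<inter> L"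
  proof (rule image_subsetI)
    fix x assume x: "x \<in> crossing_arcs (inside L)"
    have "point D (?g x) \<in> L" using f[OF x] g(2)[OF x] by simp
    with g(1)[OF x] show "point D (?g x) \<in> point D ` sites D \<inter> L" by blast
  qed
  \<comment> \<open>\<open>card\<close> is 0 on infinite sets, so the positive count yields
    finiteness.\<close>
  moreover have "finite (point D ` sites D \<inter> L)" using card card_gt_0_iff by blast
  ultimately have "card (crossing_arcs (inside L)) \<le> card (point D ` sites D \<inter> L)"
    by (rule card_inj_on_le)
  with card(1) show ?thesis by simp
qed

end

section \<open>Euler systems\<close>

context oriented_diagram
begin

section \<open>Connected components of the universe\<close>

lemma fin_digraph_universe: "fin_digraph (universe D)"
  using finite_arcs finite_classical tail_in_classical next_site_in_arcs
  by unfold_locales auto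

lemma component_subset:
  assumes "K \<in> universe_components D"
  shows "K \<subseteq> classical D" and "K \<noteq> {}"
proof -
  interpret fin_digraph "universe D" by (rule fin_digraph_universe)
  interpret sym: pair_wf_digraph "mk_symmetric (universe D)" ..
  show "K \<subseteq> classical D"
    using sym.sccs_verts_subsets[of K] assms
    by (auto simp: universe_components_def mk_symmetric_def)
  show "K \<noteq> {}" using assms by (simp add: universe_components_def sym.sccs_verts_def)
qed

lemma component_disjoint:
  assumes "K \<in> universe_components D" "K' \<in> universe_components D" "v \<in> K" "v \<in> K'"
  shows "K = K'"
proof -
  interpret fin_digraph "universe D" by (rule fin_digraph_universe)
  interpret sym: pair_wf_digraph "mk_symmetric (universe D)" ..
  show ?thesis
    using sym.sccs_verts_disjoint assms unfolding universe_components_def by blast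
qed

text \<open>In the symmetrized universe the ends of an arc are reachable from each other. Hence
  restricting the universe to a component cuts no arc.\<close>

lemma component_closed:
  assumes "K \<in> universe_components D" and "x \<in> arcs (universe D)"
  shows "point D x \<in> K \<longleftrightarrow> point D (next_site D x) \<in> K"
proof -
  interpret fin_digraph "universe D" by (rule fin_digraph_universe)
  interpret sym: pair_wf_digraph "mk_symmetric (universe D)" ..
  have "(point D x, point D (next_site D x)) \<in> parcs (mk_symmetric (universe D))"
    "(point D (next_site D x), point D x) \<in> parcs (mk_symmetric (universe D))"
    using assms(2) by (auto simp: mk_symmetric_def)
  then have "point D x \<rightarrow>\<^sup>*\<^bsub>mk_symmetric (universe D)\<^esub> point D (next_site D x)"
    "point D (next_site D x) \<rightarrow>\<^sup>*\<^bsub>mk_symmetric (universe D)\<^esub> point D x"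
    by (auto intro!: sym.reachable_adjI simp: arcs_ends_def arc_to_ends_def image_iff)
  with assms(1) show ?thesis
    unfolding universe_components_def sym.sccs_verts_def by blast
qed

section \<open>Euler circuits of a single component\<close>

lemma ex_arc:
  assumes "p \<in> classical D"
  obtains x where "x \<in> arcs (universe D)" "point D x = p"
proof -
  have "{x \<in> arcs (universe D). point D x = p} \<noteq> {}"
    using card_tail_eq[OF assms] by (metis card.empty universe_simps(2) zero_neq_numeral)
  with that show ?thesis by blast
qed

abbreviation component_arcs :: "complex set \<Rightarrow> site set" where
  "component_arcs K \<equiv> {x \<in> arcs (universe D). point D x \<in> K}"

lemma component_arcs_nonempty: "K \<in> universe_components D \<Longrightarrow> component_arcs K \<noteq> {}"
  using component_subset[of K] ex_arc by blast

text \<open>This only says that consecutive ends fit together. Restriction to a component keeps the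
  end maps, so one predicate serves all components.\<close>

abbreviation chain :: "complex \<Rightarrow> site list \<Rightarrow> complex \<Rightarrow> bool" where
  "chain \<equiv> pre_digraph.cas (universe D)"

text \<open>No arc leaves \<open>K\<close>, so the restricted universe has exactly the arcs starting
  in \<open>K\<close>. Visiting all vertices follows from using all arcs, as each crossing in
  \<open>K\<close> is the tail of one. Later arguments can thus work with lists of arcs
  alone.\<close>

lemma euler_circuit_iff:
  assumes "K \<in> universe_components D"
  shows "euler_circuit D K p \<longleftrightarrow>
    distinct p \<and> set p = component_arcs K \<and> (\<exists>u. chain u p u)"
proof -
  interpret fin_digraph "universe D" by (rule fin_digraph_universe)
  let ?G = "universe D \<restriction> K"
  have K: "K \<subseteq> classical D" by (rule component_subset[OF assms])
  interpret ind: fin_digraph ?G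
    using finite_subset[OF K finite_classical] finite_arcs by unfold_locales auto
  have arcs: "arcs ?G = component_arcs K"
    using component_closed[OF assms] by auto
  have chain: "ind.cas = chain"
    by (rule compatible_cas[OF compatible_induce_subgraph])
  have tails: "point D ` component_arcs K = K"
    using K ex_arc by blast
  have "set (ind.awalk_verts u p) = K" if "chain u p u" "set p = component_arcs K" for u
  proof -
    have "p \<noteq> []" using that component_arcs_nonempty[OF assms] by auto
    with that(1) have "set (ind.awalk_verts u p) = point D ` set p \<union> (\<lambda>x. point D (next_site D x)) ` set p"
      by (subst ind.set_awalk_verts_not_Nil_cas) (auto simp: chain)
    with that(2) show ?thesis
      using tails component_closed[OF assms] by auto
  qed
  moreover have "u \<in> K" if "chain u p u" "set p = component_arcs K" for u
    using that component_arcs_nonempty[OF assms]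
    by (cases p) (auto simp: pre_digraph.cas.simps)
  ultimately show ?thesis
    unfolding euler_circuit_def ind.euler_trail_def ind.trail_def ind.awalk_def arcs chain
    by auto blast
qed

text \<open>The restriction to \<open>K\<close> is connected and all in-degrees and out-degrees are
  2, so Euler's theorem applies.\<close>

lemma ex_euler_circuit:
  assumes "K \<in> universe_components D"
  shows "\<exists>p. euler_circuit D K p"
proof -
  interpret fin_digraph "universe D" by (rule fin_digraph_universe)
  interpret sym: pair_wf_digraph "mk_symmetric (universe D)" ..
  let ?G = "universe D \<restriction> K"
  have K: "K \<subseteq> classical D" by (rule component_subset[OF assms])
  interpret ind: fin_digraph ?G
    using finite_subset[OF K finite_classical] finite_arcs by unfold_locales auto
  have arcs: "arcs ?G = component_arcs K"
    using component_closed[OF assms] by auto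
  have "max_reachable_set (mk_symmetric (universe D)) K"
    using assms unfolding universe_components_def
    by unfold_locales
  then have "strongly_connected (with_proj (mk_symmetric (universe D)) \<restriction> K)"
    by (rule max_reachable_set.strongly_connected)
  \<comment> \<open>Components are taken in the symmetrization of the whole universe, while
    connectedness of the restriction refers to its own symmetrization; the two operations
    commute.\<close>
  moreover have "with_proj (mk_symmetric (universe D)) \<restriction> K = with_proj (mk_symmetric ?G)"
    by (auto simp: mk_symmetric_def induce_subgraph_def with_proj_def)
  ultimately have "Digraph_Component.connected ?G"
    by (simp add: Digraph_Component.connected_def)
  moreover have "in_degree ?G v = out_degree ?G v" if "v \<in> verts ?G" for v
  proof -
    have v: "v \<in> classical D" "v \<in> K" using that K by auto
    then have "in_arcs ?G v = {x \<in> arcs (universe D). head (universe D) x = v}"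
      "out_arcs ?G v = {x \<in> arcs (universe D). tail (universe D) x = v}"
      using component_closed[OF assms] unfolding in_arcs_def out_arcs_def arcs by auto
    with v show ?thesis
      using card_head_eq card_tail_eq by (simp add: in_degree_def out_degree_def)
  qed
  ultimately show ?thesis
    unfolding euler_circuit_def using ind.closed_euler1 by blast
qed

section \<open>Existence of Euler systems and exchange of circuits\<close>

lemma ex_euler_system: "\<exists>C. euler_system D C"
proof -
  define f where "f K = (SOME p. euler_circuit D K p)" for K
  have f: "euler_circuit D K (f K)" if "K \<in> universe_components D" for K
    unfolding f_def using ex_euler_circuit[OF that] by (rule someI_ex)
  \<comment> \<open>The arcs of a circuit determine its component, so the list chosen for one
    component cannot serve another.\<close>
  have f_inj: "K' = K" if K: "K \<in> universe_components D" "K' \<in> universe_components D"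
    and "euler_circuit D K (f K')" for K K'
  proof -
    have "component_arcs K = component_arcs K'"
      using f[OF K(2)] that(3) by (simp add: euler_circuit_iff K)
    moreover obtain x where "x \<in> component_arcs K" using component_arcs_nonempty[OF K(1)] by blast
    ultimately show ?thesis using component_disjoint[OF K] by blast
  qed
  let ?C = "Free_Loop ` universe_free_loops D \<union> (\<lambda>K. Arc_Circuit (f K)) ` universe_components D"
  have "euler_system D ?C"
    unfolding euler_system_def
  proof (intro conjI allI ballI impI)
    fix K assume K: "K \<in> universe_components D"
    show "\<exists>!p. Arc_Circuit p \<in> ?C \<and> euler_circuit D K p"
    proof (rule ex1I[of _ "f K"])
      show "Arc_Circuit (f K) \<in> ?C \<and> euler_circuit D K (f K)" using K f by blast
      fix p assume p: "Arc_Circuit p \<in> ?C \<and> euler_circuit D K p"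
      then obtain K' where "K' \<in> universe_components D" "p = f K'" by auto
      with f_inj[OF K, of K'] p show "p = f K" by simp
    qed
  next
    fix p assume "Arc_Circuit p \<in> ?C"
    then show "\<exists>K\<in>universe_components D. euler_circuit D K p" using f by blast
  qed auto
  then show ?thesis ..
qed

lemma euler_systemD:
  assumes "euler_system D C" "Arc_Circuit p \<in> C"
  obtains K where "K \<in> universe_components D" "euler_circuit D K p" "distinct p"
    "set p = component_arcs K" "\<exists>u. chain u p u"
proof -
  obtain K where "K \<in> universe_components D" "euler_circuit D K p"
    using assms unfolding euler_system_def by blast
  with that euler_circuit_iff show ?thesis by simp
qed

lemma euler_system_unique:
  assumes C: "euler_system D C" and p: "Arc_Circuit p \<in> C" and q: "Arc_Circuit q \<in> C"
    and x: "x \<in> set p" "x \<in> set q"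
  shows "p = q"
proof -
  obtain K where K: "K \<in> universe_components D" "euler_circuit D K p" "set p = component_arcs K"
    using C p by (rule euler_systemD)
  obtain K' where K': "K' \<in> universe_components D" "euler_circuit D K' q" "set q = component_arcs K'"
    using C q by (rule euler_systemD)
  have "K = K'" using K K' x component_disjoint[of K K' "point D x"] by auto
  moreover have "\<exists>!p. Arc_Circuit p \<in> C \<and> euler_circuit D K p"
    using C K(1) by (simp add: euler_system_def)
  ultimately show ?thesis using p q K(2) K'(2) by auto
qed

text \<open>Being an Euler circuit of a component depends only on distinctness, closure and the set
  of arcs. So \<open>q\<close> takes the place of \<open>p\<close> for the same component and for no
  other.\<close>

lemma euler_system_replace:
  assumes C: "euler_system D C" and p: "Arc_Circuit p \<in> C"
    and q: "distinct q" "set q = set p" "chain u q u"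
  shows "euler_system D (C - {Arc_Circuit p} \<union> {Arc_Circuit q})" (is "euler_system D ?C")
proof -
  obtain K where K: "K \<in> universe_components D" "euler_circuit D K p" "set p = component_arcs K"
    using C p by (rule euler_systemD)
  have eq: "euler_circuit D K' q \<longleftrightarrow> euler_circuit D K' p" if "K' \<in> universe_components D" for K'
    using euler_circuit_iff[OF that] euler_circuit_iff[OF K(1)] q K(2) by auto
  show ?thesis
    unfolding euler_system_def
  proof (intro conjI allI ballI impI)
    fix i
    show "Free_Loop i \<in> ?C \<longleftrightarrow> i \<in> universe_free_loops D"
      using C by (simp add: euler_system_def)
  next
    fix r assume "Arc_Circuit r \<in> ?C"
    then show "\<exists>K\<in>universe_components D. euler_circuit D K r"
      using C K eq by (auto simp: euler_system_def)
  next
    fix K' assume K': "K' \<in> universe_components D"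
    then obtain r where r: "Arc_Circuit r \<in> C" "euler_circuit D K' r"
      "\<And>s. Arc_Circuit s \<in> C \<Longrightarrow> euler_circuit D K' s \<Longrightarrow> s = r"
    proof -
      have "\<exists>!r. Arc_Circuit r \<in> C \<and> euler_circuit D K' r"
        using C K' by (simp add: euler_system_def)
      with that show ?thesis by blast
    qed
    show "\<exists>!s. Arc_Circuit s \<in> ?C \<and> euler_circuit D K' s"
    proof (cases "r = p")
      case True
      show ?thesis
      proof (rule ex1I[of _ q])
        show "Arc_Circuit q \<in> ?C \<and> euler_circuit D K' q" using r(2) eq[OF K'] True by simp
        fix s assume "Arc_Circuit s \<in> ?C \<and> euler_circuit D K' s"
        then show "s = q" using r(3)[of s] True by auto
      qed
    next
      case False
      then have not_q: "\<not> euler_circuit D K' q" using r(3)[OF p] eq[OF K'] by auto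
      show ?thesis
      proof (rule ex1I[of _ r])
        show "Arc_Circuit r \<in> ?C \<and> euler_circuit D K' r" using r(1,2) False by simp
        fix s assume "Arc_Circuit s \<in> ?C \<and> euler_circuit D K' s"
        then show "s = r" using r(3)[of s] not_q by auto
      qed
    qed
  qed
qed

end

section \<open>Transpositions\<close>

definition adjacent_pairs :: "'a list \<Rightarrow> ('a \<times> 'a) set" where
  "adjacent_pairs xs = set (zip xs (tl xs))"

text \<open>Marks depend on a circuit only through these transitions, which, unlike the list, do not
  change with the starting point.\<close>

definition cyclic_pairs :: "'a list \<Rightarrow> ('a \<times> 'a) set" where
  "cyclic_pairs xs = set (zip xs (rotate1 xs))"

lemma adjacent_pairs_append:
  assumes "xs \<noteq> []" "ys \<noteq> []"
  shows "adjacent_pairs (xs @ ys) = adjacent_pairs xs \<union> {(last xs, hd ys)} \<union> adjacent_pairs ys"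
  using assms(1)
proof (induction xs rule: list_nonempty_induct)
  case (single x)
  obtain b bs where "ys = b # bs" using assms(2) by (cases ys) auto
  then show ?case by (simp add: adjacent_pairs_def)
next
  case (cons x xs)
  then obtain b bs where "xs = b # bs" by (cases xs) auto
  with cons show ?case by (simp add: adjacent_pairs_def insert_commute)
qed

lemma cyclic_pairs_conv:
  assumes "xs \<noteq> []"
  shows "cyclic_pairs xs = insert (last xs, hd xs) (adjacent_pairs xs)"
proof -
  have "set (zip ys (tl ys @ [z])) = insert (last ys, z) (adjacent_pairs ys)" if "ys \<noteq> []" for ys z
    using that
  proof (induction ys rule: list_nonempty_induct)
    case (cons y ys)
    then show ?case by (cases ys) (auto simp: adjacent_pairs_def)
  qed (simp add: adjacent_pairs_def)
  moreover have "rotate1 xs = tl xs @ [hd xs]" using assms by (cases xs) auto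
  ultimately show ?thesis using assms by (simp add: cyclic_pairs_def)
qed

lemma cyclic_pairs_append_commute: "cyclic_pairs (xs @ ys) = cyclic_pairs (ys @ xs)"
  by (cases "xs = []"; cases "ys = []") (auto simp: cyclic_pairs_conv adjacent_pairs_append)

text \<open>This form shows that permuting the four blocks changes only the pairs at the
  junctions.\<close>

lemma cyclic_pairs_append4:
  assumes "as \<noteq> []" "bs \<noteq> []" "cs \<noteq> []" "ds \<noteq> []"
  shows "cyclic_pairs (as @ bs @ cs @ ds) =
    adjacent_pairs as \<union> adjacent_pairs bs \<union> adjacent_pairs cs \<union> adjacent_pairs ds \<union>
    {(last as, hd bs), (last bs, hd cs), (last cs, hd ds), (last ds, hd as)}"
  using assms by (auto simp: cyclic_pairs_conv adjacent_pairs_append)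

lemma adjacent_pairs_fst:
  assumes "(x, y) \<in> adjacent_pairs xs"
  shows "x \<in> set xs" and "distinct xs \<Longrightarrow> x \<noteq> last xs"
proof -
  obtain k where k: "k < length xs - 1" "x = xs ! k"
    using assms by (auto simp: adjacent_pairs_def set_zip)
  then show "x \<in> set xs" by simp
  show "x \<noteq> last xs" if "distinct xs"
    using k that by (cases xs rule: rev_cases) (auto simp: nth_append nth_eq_iff_index_eq in_set_conv_nth)
qed

lemma cyclic_pairs_fst: "(x, y) \<in> cyclic_pairs xs \<Longrightarrow> x \<in> set xs"
  by (auto simp: cyclic_pairs_def dest: set_zip_leftD)

lemma cyclic_pairs_iff:
  "(x, y) \<in> cyclic_pairs xs \<longleftrightarrow>
    (\<exists>k < length xs. x = xs ! k \<and> y = xs ! (Suc k mod length xs))"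
  unfolding cyclic_pairs_def set_zip by (simp add: nth_rotate1 conj_commute cong: conj_cong)

lemma doubleton_if_card_2:
  assumes "card S = 2" "a \<in> S" "b \<in> S" "a \<noteq> b"
  shows "S = {a, b}"
  using assms by (auto simp: card_2_iff)

context oriented_diagram
begin

section \<open>Transposing an Euler circuit at two interlaced marked crossings\<close>

lemma chain_append: "chain u (xs @ ys) v \<longleftrightarrow> (\<exists>m. chain u xs m \<and> chain m ys v)"
  by (induction xs arbitrary: u) (auto simp: pre_digraph.cas.simps)

lemma chain_ends:
  assumes "chain u xs v" "xs \<noteq> []"
  shows "u = point D (hd xs)" and "v = point D (next_site D (last xs))"
proof -
  show "u = point D (hd xs)" using assms by (cases xs) (auto simp: pre_digraph.cas.simps)
  show "v = point D (next_site D (last xs))"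
    using assms
    by (cases xs rule: rev_cases) (auto simp: pre_digraph.cas.simps chain_append)
qed

lemma marked_crossings_iff:
  "v \<in> marked_crossings D C \<longleftrightarrow> v \<in> classical D \<and>
    (\<exists>p x y. Arc_Circuit p \<in> C \<and> (x, y) \<in> cyclic_pairs p \<and>
      point D (next_site D x) = v \<and> y \<noteq> next_site D x)"
  unfolding marked_crossings_def cyclic_pairs_iff universe_simps by blast

text \<open>
  The transposition at two interlaced crossings exchanges the two segments of the circuit that
  run from one to the other.  The crossings that are marked change at these two only.
\<close>

lemma transposition_split:
  assumes C: "euler_system D C" and p: "Arc_Circuit p \<in> C"
    and rot: "p = es' @ as @ bs @ cs @ es''"
    and ne: "as \<noteq> []" "bs \<noteq> []" "cs \<noteq> []" "es'' \<noteq> []"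
    and v: "point D (hd as) = v" "point D (hd cs) = v" "v \<in> marked_crossings D C"
    and w: "point D (hd bs) = w" "point D (hd es'') = w" "w \<in> marked_crossings D C"
  shows "\<exists>C'. euler_system D C' \<and> marked_crossings D C' \<subset> marked_crossings D C"
proof -
  \<comment> \<open>The fourth piece wraps around the end of the list. \<open>as\<close> and
    \<open>cs\<close> both run from \<open>v\<close> to \<open>w\<close>, while \<open>bs\<close>
    and \<open>ds\<close> run back, so exchanging \<open>as\<close> with \<open>cs\<close> leaves a
    closed circuit.\<close>
  define ds where "ds = es'' @ es'"
  define q where "q = cs @ bs @ as @ ds"
  define C' where "C' = C - {Arc_Circuit p} \<union> {Arc_Circuit q}"
  have ds: "ds \<noteq> []" "hd ds = hd es''" using ne by (simp_all add: ds_def)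
  obtain K u where K: "K \<in> universe_components D" "distinct p" "set p = component_arcs K" "chain u p u"
    using C p by (rule euler_systemD) blast
  have "chain v as w" "chain w bs v" "chain v cs w" "chain w ds v"
  proof -
    obtain m1 m2 m3 m4 where m: "chain u es' m1" "chain m1 as m2" "chain m2 bs m3" "chain m3 cs m4"
      "chain m4 es'' u"
      using K(4) unfolding rot chain_append by blast
    moreover have "m1 = v" "m2 = w" "m3 = v" "m4 = w"
      using chain_ends(1)[OF m(2) ne(1)] chain_ends(1)[OF m(3) ne(2)]
        chain_ends(1)[OF m(4) ne(3)] chain_ends(1)[OF m(5) ne(4)] v w by simp_all
    ultimately show "chain v as w" "chain w bs v" "chain v cs w" "chain w ds v"
      unfolding ds_def chain_append by auto
  qed
  note chains = this
  then have "chain v q v" unfolding q_def chain_append by blast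
  moreover have dist: "distinct (as @ bs @ cs @ ds)" "distinct q" and setq: "set q = set p"
  proof -
    have "mset (as @ bs @ cs @ ds) = mset p" and q: "mset q = mset p"
      by (simp_all add: rot ds_def q_def add_ac)
    with K(2) show "distinct (as @ bs @ cs @ ds)" "distinct q"
      using mset_eq_imp_distinct_iff by blast+
    show "set q = set p" using q by (rule mset_eq_setD)
  qed
  ultimately have C': "euler_system D C'"
    unfolding C'_def using euler_system_replace[OF C p] by blast
  have cyc_p: "cyclic_pairs p = adjacent_pairs as \<union> adjacent_pairs bs \<union> adjacent_pairs cs \<union>
      adjacent_pairs ds \<union> {(last as, hd bs), (last bs, hd cs), (last cs, hd ds), (last ds, hd as)}"
    unfolding rot ds_def cyclic_pairs_append_commute[of es']
    using cyclic_pairs_append4[OF ne(1-3) ds(1)] by (simp add: ds_def)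
  have cyc_q: "cyclic_pairs q = adjacent_pairs as \<union> adjacent_pairs bs \<union> adjacent_pairs cs \<union>
      adjacent_pairs ds \<union> {(last as, hd ds), (last bs, hd as), (last cs, hd bs), (last ds, hd cs)}"
    unfolding q_def using cyclic_pairs_append4[OF ne(3,2,1) ds(1)] by blast
  have lasts: "last as \<in> set as" "last bs \<in> set bs" "last cs \<in> set cs" "last ds \<in> set ds"
    and hds: "hd as \<in> set as" "hd cs \<in> set cs"
    using ne ds by auto
  have set_p: "set p = set as \<union> set bs \<union> set cs \<union> set ds" by (simp add: rot ds_def Un_ac)
  have heads: "point D (next_site D (last as)) = w" "point D (next_site D (last bs)) = v"
    "point D (next_site D (last cs)) = w" "point D (next_site D (last ds)) = v"
    using chains chain_ends(2) ne ds by auto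
  have arcs: "set p \<subseteq> arcs (universe D)" using K(3) by blast
  have v_cl: "v \<in> classical D" using v(3) by (simp add: marked_crossings_def)
  have disj: "\<And>x. x \<in> set as \<Longrightarrow> x \<notin> set bs \<and> x \<notin> set cs \<and> x \<notin> set ds"
    "\<And>x. x \<in> set bs \<Longrightarrow> x \<notin> set cs \<and> x \<notin> set ds" "\<And>x. x \<in> set cs \<Longrightarrow> x \<notin> set ds"
    using dist(1) by auto
  have neq: "last bs \<noteq> last ds" "last ds \<noteq> last bs" "hd as \<noteq> hd cs"
    "last as \<noteq> last bs" "last as \<noteq> last ds" "last cs \<noteq> last bs" "last cs \<noteq> last ds"
    using lasts hds disj by metis+
  have in_arcs: "last bs \<in> arcs (universe D)" "last ds \<in> arcs (universe D)"
    "hd as \<in> arcs (universe D)" "hd cs \<in> arcs (universe D)"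
    using lasts hds set_p arcs by auto
  \<comment> \<open>Exactly two arcs enter \<open>v\<close> and two leave it, so there are only two
    ways to pair them: \<open>p\<close> uses one and \<open>q\<close> the other.\<close>
  have in_v: "{x \<in> arcs (universe D). point D (next_site D x) = v} = {last bs, last ds}"
    using card_head_eq[OF v_cl] heads in_arcs neq by (intro doubleton_if_card_2) simp_all
  have out_v: "{x \<in> arcs (universe D). point D x = v} = {hd as, hd cs}"
    using card_tail_eq[OF v_cl] v in_arcs neq by (intro doubleton_if_card_2) simp_all
  \<comment> \<open>The arcs entering \<open>v\<close> are the last ones of their blocks, so what
    follows them is decided at the junctions.\<close>
  have inner: "(x, y) \<notin> adjacent_pairs xs"
    if "x = last bs \<or> x = last ds" "xs = as \<or> xs = bs \<or> xs = cs \<or> xs = ds" for x y xs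
  proof
    assume xy: "(x, y) \<in> adjacent_pairs xs"
    have "distinct xs" using that(2) dist(1) by auto
    then have "x \<in> set xs" "x \<noteq> last xs" using adjacent_pairs_fst[OF xy] by auto
    then show False using that lasts disj by metis
  qed
  have p_succ: "(x = last bs \<longrightarrow> y = hd cs) \<and> (x = last ds \<longrightarrow> y = hd as)"
    if "(x, y) \<in> cyclic_pairs p" for x y
    using that neq inner[of x as y] inner[of x bs y] inner[of x cs y] inner[of x ds y]
    unfolding cyc_p by auto
  have q_succ: "(x = last bs \<longrightarrow> y = hd as) \<and> (x = last ds \<longrightarrow> y = hd cs)"
    if "(x, y) \<in> cyclic_pairs q" for x y
    using that neq inner[of x as y] inner[of x bs y] inner[of x cs y] inner[of x ds y]
    unfolding cyc_q by auto
  have next_v: "next_site D (last bs) \<in> {hd as, hd cs}" "next_site D (last ds) \<in> {hd as, hd cs}"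
    using out_v heads next_site_in_arcs in_arcs by blast+
  moreover have "next_site D (last bs) \<noteq> next_site D (last ds)"
    using inj_on_next_site in_arcs neq by (auto dest: inj_onD)
  \<comment> \<open>As \<open>v\<close> is marked, some transition there departs from the link
    component, and it belongs to \<open>p\<close> because the arcs entering \<open>v\<close> do. So
    \<open>p\<close> does not pair the arcs as the link components do, and therefore
    \<open>q\<close> does.\<close>
  moreover have "next_site D (last bs) \<noteq> hd cs \<or> next_site D (last ds) \<noteq> hd as"
  proof -
    obtain r x y where r: "Arc_Circuit r \<in> C" "(x, y) \<in> cyclic_pairs r"
      "point D (next_site D x) = v" "y \<noteq> next_site D x"
      using v(3) unfolding marked_crossings_iff by blast
    obtain L where "set r = component_arcs L" using C r(1) by (rule euler_systemD)
    then have "x \<in> set r" "x \<in> arcs (universe D)" using cyclic_pairs_fst[OF r(2)] by auto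
    then have x: "x = last bs \<or> x = last ds" using in_v r(3) by blast
    then have "x \<in> set p" using lasts set_p by auto
    then have "r = p" using euler_system_unique[OF C r(1) p] \<open>x \<in> set r\<close> by blast
    with r(2,4) x p_succ[of x y] show ?thesis by auto
  qed
  ultimately have next_v: "next_site D (last bs) = hd as" "next_site D (last ds) = hd cs"
    by auto
  have "v \<notin> marked_crossings D C'"
  proof
    assume "v \<in> marked_crossings D C'"
    then obtain r x y where r: "Arc_Circuit r \<in> C'" "(x, y) \<in> cyclic_pairs r"
      "point D (next_site D x) = v" "y \<noteq> next_site D x"
      unfolding marked_crossings_iff by blast
    obtain L where "set r = component_arcs L" using C' r(1) by (rule euler_systemD)
    then have "x \<in> set r" "x \<in> arcs (universe D)" using cyclic_pairs_fst[OF r(2)] by auto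
    then have x: "x = last bs \<or> x = last ds" using in_v r(3) by blast
    then have "x \<in> set q" using lasts set_p setq by auto
    moreover have "Arc_Circuit q \<in> C'" by (simp add: C'_def)
    ultimately have "r = q" using euler_system_unique[OF C' r(1)] \<open>x \<in> set r\<close> by blast
    with r(2,4) x q_succ[of x y] next_v show False by auto
  qed
  moreover have "marked_crossings D C' \<subseteq> marked_crossings D C"
  proof
    fix z assume z: "z \<in> marked_crossings D C'"
    then obtain r x y where r: "Arc_Circuit r \<in> C'" "(x, y) \<in> cyclic_pairs r"
      "point D (next_site D x) = z" "y \<noteq> next_site D x"
      unfolding marked_crossings_iff by blast
    show "z \<in> marked_crossings D C"
    \<comment> \<open>Losing \<open>v\<close> makes the inclusion strict, and \<open>w\<close> was
      marked before, so only other crossings need an argument. Junction arcs end at \<open>v\<close>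
      or \<open>w\<close>; a transition of \<open>q\<close> at another crossing thus lies within a
      block and also occurs in \<open>p\<close>.\<close>
    proof (cases "z = v \<or> z = w")
      case True
      with v(3) w(3) show ?thesis by auto
    next
      case False
      then have x: "x \<noteq> last as" "x \<noteq> last bs" "x \<noteq> last cs" "x \<noteq> last ds"
        using r(3) heads by auto
      have "\<exists>r. Arc_Circuit r \<in> C \<and> (x, y) \<in> cyclic_pairs r"
      proof (cases "r = q")
        case True
        then have "(x, y) \<in> cyclic_pairs q" using r(2) by simp
        then have "(x, y) \<in> cyclic_pairs p" using x unfolding cyc_p cyc_q by simp
        with p show ?thesis by blast
      next
        case False
        with r(1,2) show ?thesis by (auto simp: C'_def)
      qed
      with r z show ?thesis unfolding marked_crossings_iff by blast
    qed
  qed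
  ultimately show ?thesis using C' v(3) by blast
qed

lemma ex_fewer_marked_crossings:
  assumes C: "euler_system D C" and vw: "interlaced D C v w"
    and marked: "v \<in> marked_crossings D C" "w \<in> marked_crossings D C"
  shows "\<exists>C'. euler_system D C' \<and> marked_crossings D C' \<subset> marked_crossings D C"
proof -
  have *: ?thesis
    if p: "Arc_Circuit p \<in> C" and ijkl: "i < j" "j < k" "k < l" "l < length p"
      and m: "point D (p ! i) = v" "point D (p ! j) = w" "point D (p ! k) = v" "point D (p ! l) = w"
      and marked: "v \<in> marked_crossings D C" "w \<in> marked_crossings D C"
    for p i j k l v w
  proof -
    \<comment> \<open>The segment includes position \<open>m\<close> and excludes \<open>n\<close>,
      so the cuts fall on the arcs that start at \<open>v\<close> or \<open>w\<close>. The part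
      before \<open>i\<close> may be empty.\<close>
    define seg where "seg m n = take (n - m) (drop m p)" for m n
    have seg: "drop m p = seg m n @ drop n p" "seg m n \<noteq> []" "hd (seg m n) = p ! m"
      if "m < n" "n < length p" for m n
    proof -
      have "drop (n - m) (drop m p) = drop n p" using that by simp
      then show "drop m p = seg m n @ drop n p" unfolding seg_def by (metis append_take_drop_id)
      show "seg m n \<noteq> []" "hd (seg m n) = p ! m"
        using that by (simp_all add: seg_def hd_drop_conv_nth)
    qed
    have "p = take i p @ drop i p" by simp
    then have "p = take i p @ seg i j @ seg j k @ seg k l @ drop l p"
      using seg(1)[of i j] seg(1)[of j k] seg(1)[of k l] ijkl by simp
    moreover have "drop l p \<noteq> []" "hd (drop l p) = p ! l"
      using ijkl by (simp_all add: hd_drop_conv_nth)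
    ultimately show ?thesis
      using transposition_split[OF C p, of "take i p" "seg i j" "seg j k" "seg k l" "drop l p" v w]
        seg(2,3)[of i j] seg(2,3)[of j k] seg(2,3)[of k l] ijkl m marked by simp
  qed
  obtain p i j k l where p: "Arc_Circuit p \<in> C" "i < j" "j < k" "k < l" "l < length p"
    and m: "point D (p ! i) = v \<and> point D (p ! j) = w \<and> point D (p ! k) = v \<and> point D (p ! l) = w \<or>
      point D (p ! i) = w \<and> point D (p ! j) = v \<and> point D (p ! k) = w \<and> point D (p ! l) = v"
    using vw unfolding interlaced_def Let_def universe_simps by blast
  from m show ?thesis using *[OF p, of v w] *[OF p, of w v] marked by blast
qed

end

section \<open>Interlacement across a tangle\<close>

context oriented_diagram
begin

section \<open>Interlacement as alternation along a circuit\<close>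

lemma interlaced_iff:
  "interlaced D C v w \<longleftrightarrow>
    (\<exists>p. Arc_Circuit p \<in> C \<and> alternating (\<lambda>n. point D (p ! n)) (length p) v w)"
  unfolding interlaced_def alternating_def Let_def universe_simps by (rule refl)

lemma interlaced_commute: "interlaced D C v w \<longleftrightarrow> interlaced D C w v"
  unfolding interlaced_iff by (subst alternating_commute) (rule refl)

lemma chain_nth:
  assumes "chain u p v" "Suc k < length p"
  shows "point D (next_site D (p ! k)) = point D (p ! Suc k)"
  using assms
proof (induction p arbitrary: u k)
  case (Cons x p)
  then show ?case
    using chain_ends(1)[of _ p v]
    by (cases k) (auto simp: pre_digraph.cas.simps hd_conv_nth)
qed simp

lemma finite_crossing_arcs: "finite (crossing_arcs R)"
  using finite_arcs by (rule rev_finite_subset) (auto simp: crossing_arcs_def)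

text \<open>Each switch happens along an arc whose ends are on different sides, and different
  positions hold different arcs. Intersecting with \<open>set p\<close> allows the counts of
  different circuits to be added.\<close>

lemma switches_le_card_crossing_arcs:
  assumes p: "distinct p" "chain u p v" "set p \<subseteq> arcs (universe D)" and n: "n < length p"
  shows "switches (\<lambda>n. point D (p ! n) \<in> R) n \<le> card (crossing_arcs R \<inter> set p)"
  unfolding switches_def
proof (rule card_inj_on_le)
  let ?K = "{k. k < n \<and> (point D (p ! k) \<in> R) \<noteq> (point D (p ! Suc k) \<in> R)}"
  show "inj_on ((!) p) ?K" using p(1) n by (auto simp: inj_on_def nth_eq_iff_index_eq)
  show "(!) p ` ?K \<subseteq> crossing_arcs R \<inter> set p"
  proof (rule image_subsetI)
    fix k assume k: "k \<in> ?K"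
    then have "p ! k \<in> set p" using n by simp
    moreover have "point D (next_site D (p ! k)) = point D (p ! Suc k)"
      using k n by (intro chain_nth[OF p(2)]) simp
    ultimately show "p ! k \<in> crossing_arcs R \<inter> set p"
      using k p(3) by (auto simp: crossing_arcs_def)
  qed
  show "finite (crossing_arcs R \<inter> set p)" by simp
qed

text \<open>Each of the two interlacements uses at least three of the at most four arcs between the
  sides. Different circuits of the system share no arc, so both occur in one circuit, where
  \<open>alternating_rectangle\<close> applies.\<close>

lemma interlaced_rectangle:
  assumes C: "euler_system D C" and card: "card (crossing_arcs R) \<le> 4"
    and il: "interlaced D C v w" "interlaced D C v' w'"
    and R: "(v \<in> R) \<noteq> (w \<in> R)" "v' \<in> R \<longleftrightarrow> v \<in> R" "w' \<in> R \<longleftrightarrow> w \<in> R"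
  shows "interlaced D C v w'"
proof -
  let ?m = "\<lambda>p n. point D (p ! n)"
  have sw: "switches (\<lambda>n. ?m p n \<in> R) n \<le> card (crossing_arcs R \<inter> set p)"
    if p: "Arc_Circuit p \<in> C" "n < length p" for p n
  proof -
    obtain K where "distinct p" "set p = component_arcs K" "\<exists>u. chain u p u"
      using C p(1) by (rule euler_systemD)
    moreover then obtain u where "chain u p u" by blast
    ultimately show ?thesis
      by (intro switches_le_card_crossing_arcs[OF _ _ _ p(2)]) auto
  qed
  have sw4: "switches (\<lambda>n. ?m p n \<in> R) n \<le> 4" if "Arc_Circuit p \<in> C" "n < length p" for p n
  proof -
    have "card (crossing_arcs R \<inter> set p) \<le> card (crossing_arcs R)"
      using finite_crossing_arcs by (intro card_mono) auto
    with sw[OF that] card show ?thesis by linarith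
  qed
  obtain p where p: "Arc_Circuit p \<in> C" "alternating (?m p) (length p) v w"
    using il(1) unfolding interlaced_iff by blast
  obtain q where q: "Arc_Circuit q \<in> C" "alternating (?m q) (length q) v' w'"
    using il(2) unfolding interlaced_iff by blast
  have R': "(v' \<in> R) \<noteq> (w' \<in> R)" using R by simp
  obtain n where n: "n < length p" "switches (\<lambda>n. ?m p n \<in> R) n \<ge> 3"
    using alternating_switches(2)[OF p(2) R(1) sw4[OF p(1)]] by blast
  obtain n' where n': "n' < length q" "switches (\<lambda>n. ?m q n \<in> R) n' \<ge> 3"
    using alternating_switches(2)[OF q(2) R' sw4[OF q(1)]] by blast
  have "p = q"
  proof (rule ccontr)
    assume "p \<noteq> q"
    then have "set p \<inter> set q = {}" using euler_system_unique[OF C p(1) q(1)] by blast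
    then have "card (crossing_arcs R \<inter> set p \<union> crossing_arcs R \<inter> set q) =
        card (crossing_arcs R \<inter> set p) + card (crossing_arcs R \<inter> set q)"
      by (intro card_Un_disjoint) auto
    moreover have "card (crossing_arcs R \<inter> set p \<union> crossing_arcs R \<inter> set q) \<le> card (crossing_arcs R)"
      using finite_crossing_arcs by (intro card_mono) auto
    ultimately show False using sw[OF p(1) n(1)] sw[OF q(1) n'(1)] n(2) n'(2) card by linarith
  qed
  then have "alternating (?m p) (length p) v w'"
    using alternating_rectangle[OF p(2) _ R sw4[OF p(1)]] q(2) by blast
  with p(1) show ?thesis unfolding interlaced_iff by blast
qed

text \<open>The second conclusion is conditional so that one construction serves every Euler system
  as well as the specially chosen one.\<close>

lemma ex_tangle_decomposition:
  fixes A B :: "'r::comm_ring_1"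
  assumes J: "encloses_tangle D J" and C: "euler_system D C"
  obtains F H a
  where "tangle_decomposition A B D J (looped_interlacement_graph D C \<alpha> \<beta>) F H a"
    and "\<forall>v \<in> marked_crossings D C. \<forall>w \<in> marked_crossings D C. \<not> interlaced D C v w \<Longrightarrow>
      no_marked_neighbour F a \<or> no_marked_neighbour H a"
proof -
  let ?G = "looped_interlacement_graph D C \<alpha> \<beta>"
  let ?R = "inside (path_image J)"
  let ?S = "crossings_outside D J" and ?T = "crossings_inside D J"
  define E where "E = {Upair v v | v. v \<in> classical D \<and> negative_crossing D v} \<union>
    {Upair v w | v w. v \<in> classical D \<and> w \<in> classical D \<and> v \<noteq> w \<and> interlaced D C v w}"
  \<comment> \<open>\<open>M\<close> and \<open>N\<close> become the neighbourhoods of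
    \<open>a\<close>; \<open>rect\<close> shows that the cut is complete bipartite between
    them.\<close>
  define M where "M = {v \<in> ?S. \<exists>w \<in> ?T. interlaced D C v w}"
  define N where "N = {w \<in> ?T. \<exists>v \<in> ?S. interlaced D C v w}"
  have "crossings D \<inter> path_image J = {}" "card (point D ` sites D \<inter> path_image J) = 4"
    using J by (simp_all add: encloses_tangle_def)
  then have card: "card (crossing_arcs ?R) \<le> 4"
    by (intro card_crossing_arcs) simp_all
  \<comment> \<open>\<open>inside\<close> and \<open>outside\<close> partition the complement of the
    curve, and no classical crossing lies on the curve.\<close>
  have "classical D \<subseteq> - path_image J"
    using \<open>crossings D \<inter> path_image J = {}\<close> classical_subset by blast
  then have V: "classical D = ?S \<union> ?T" "?S \<inter> ?T = {}"
    using inside_Un_outside[of "path_image J"] inside_Int_outside[of "path_image J"]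
    unfolding crossings_outside_def crossings_inside_def by blast+
  have R: "v \<notin> ?R" if "v \<in> ?S" for v
    using that inside_Int_outside[of "path_image J"] unfolding crossings_outside_def by blast
  have R': "w \<in> ?R" if "w \<in> ?T" for w using that by (simp add: crossings_inside_def)
  have rect: "interlaced D C v w" if "v \<in> M" "w \<in> N" for v w
  proof -
    obtain w' where w': "v \<in> ?S" "w' \<in> ?T" "interlaced D C v w'" using \<open>v \<in> M\<close> by (auto simp: M_def)
    obtain v' where v': "w \<in> ?T" "v' \<in> ?S" "interlaced D C v' w" using \<open>w \<in> N\<close> by (auto simp: N_def)
    show ?thesis
      using interlaced_rectangle[OF C card w'(3) v'(3)] R R' w' v' by blast
  qed
  have "E \<subseteq> (\<lambda>(v, w). Upair v w) ` (classical D \<times> classical D)" by (auto simp: E_def)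
  then have fin: "finite E" using finite_classical by (auto intro: finite_subset)
  have G: "edges ?G = mset_set E" "vertices ?G = classical D" "marked ?G = marked_crossings D C"
    by (simp_all add: looped_interlacement_graph_def E_def)
  have mg: "marked_graph ?G"
    unfolding marked_graph_def G using fin finite_classical
    by (auto simp: E_def marked_crossings_def)
  \<comment> \<open>The new vertex has no geometric meaning; any point other than a classical
    crossing will do.\<close>
  obtain a where a: "a \<notin> classical D"
    using ex_new_if_finite[OF infinite_UNIV_char_0 finite_classical] by blast
  have cut: "\<forall>v \<in> ?S. \<forall>w \<in> ?T. Upair v w \<in> E \<longleftrightarrow> v \<in> M \<and> w \<in> N"
  proof (intro ballI)
    fix v w assume vw: "v \<in> ?S" "w \<in> ?T"
    then have "v \<noteq> w" "v \<in> classical D" "w \<in> classical D" using V by auto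
    then have "Upair v w \<in> E \<longleftrightarrow> interlaced D C v w"
      using interlaced_commute[of C v w] by (auto simp: E_def)
    also have "\<dots> \<longleftrightarrow> v \<in> M \<and> w \<in> N" using rect vw by (auto simp: M_def N_def)
    finally show "Upair v w \<in> E \<longleftrightarrow> v \<in> M \<and> w \<in> N" .
  qed
  have MN: "M \<subseteq> ?S" "N \<subseteq> ?T" by (auto simp: M_def N_def)
  have V': "vertices ?G = ?S \<union> ?T" "a \<notin> ?S \<union> ?T" using G(2) V(1) a by auto
  define F where "F = attach_vertex A B a M (induced_on ?G ?S)"
  define H where "H = (attach_vertex A B a N (induced_on ?G ?T))\<lparr>free_loops := 0\<rparr>"
  note comp = is_composition_cut[OF mg G(1) fin V'(1) V(2) V'(2) MN cut, where A = A and B = B,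
      folded F_def H_def]
  have nb: "no_marked_neighbour F a \<longleftrightarrow> M \<inter> marked_crossings D C = {}"
    "no_marked_neighbour H a \<longleftrightarrow> N \<inter> marked_crossings D C = {}"
    using comp(4,5) unfolding G(3) .
  show ?thesis
  proof
    show "tangle_decomposition A B D J ?G F H a"
      unfolding tangle_decomposition_def using comp(1-3) by blast
    show "no_marked_neighbour F a \<or> no_marked_neighbour H a"
      if "\<forall>v \<in> marked_crossings D C. \<forall>w \<in> marked_crossings D C. \<not> interlaced D C v w"
      using that rect unfolding nb by blast
  qed
qed

lemma ex_euler_system_no_interlaced_marked:
  obtains C where "euler_system D C"
    and "\<forall>v \<in> marked_crossings D C. \<forall>w \<in> marked_crossings D C. \<not> interlaced D C v w"
proof -
  obtain C0 where "euler_system D C0" using ex_euler_system by blast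
  then obtain C where C: "euler_system D C"
    and least: "\<And>C'. euler_system D C' \<Longrightarrow> card (marked_crossings D C) \<le> card (marked_crossings D C')"
    using ex_has_least_nat[of "euler_system D" C0 "\<lambda>C. card (marked_crossings D C)"]
    by blast
  have "finite (marked_crossings D C)"
    using finite_classical by (rule rev_finite_subset) (auto simp: marked_crossings_def)
  then have "\<not> (\<exists>C'. euler_system D C' \<and> marked_crossings D C' \<subset> marked_crossings D C)"
    using least psubset_card_mono by (metis leD)
  with that C ex_fewer_marked_crossings[OF C] show ?thesis by blast
qed

end

theorem theorem5:
  fixes D :: diagram and J :: "real \<Rightarrow> complex"
    and A B :: "'r::comm_ring_1" and \<alpha> \<beta> :: "complex \<Rightarrow> 'r"
  assumes "link_diagram D" and "encloses_tangle D J"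
  shows "(\<forall>C. euler_system D C \<longrightarrow>
            (\<exists>F H a. tangle_decomposition A B D J (looped_interlacement_graph D C \<alpha> \<beta>) F H a)) \<and>
         (\<exists>C. euler_system D C \<and>
            (\<exists>F H a. tangle_decomposition A B D J (looped_interlacement_graph D C \<alpha> \<beta>) F H a \<and>
                (no_marked_neighbour F a \<or> no_marked_neighbour H a)))"
proof (intro conjI allI impI)
  interpret oriented_diagram D by unfold_locales (rule assms(1))
  show "\<exists>F H a. tangle_decomposition A B D J (looped_interlacement_graph D C \<alpha> \<beta>) F H a"
    if "euler_system D C" for C
    using ex_tangle_decomposition[OF assms(2) that] by blast
  obtain C where C: "euler_system D C"
    and no_marked: "\<forall>v \<in> marked_crossings D C. \<forall>w \<in> marked_crossings D C. \<not> interlaced D C v w"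
    by (rule ex_euler_system_no_interlaced_marked)
  show "\<exists>C. euler_system D C \<and>
      (\<exists>F H a. tangle_decomposition A B D J (looped_interlacement_graph D C \<alpha> \<beta>) F H a \<and>
        (no_marked_neighbour F a \<or> no_marked_neighbour H a))"
    using C ex_tangle_decomposition[OF assms(2) C, of A B \<alpha> \<beta>] no_marked by metis
qed

end
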